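(* For any graph $G$ with $n$ vertices, $m$ edges and chromatic number $k$: - if $2\le k\le n-3$, then $Z_{DP}(G)\le \left\lceil \frac{4(k+1)m}{2k+1}\right\rceil$; - if $G\cong C_4$ (the cycle on four vertices), then $Z_{DP}(G)=1$; - otherwise, $Z_{DP}(G)=0$.
   Context: All graphs are finite and simple; $\mathbb{N}$ is the set of non-negative integers; $\chi(G)$ is the chromatic number. For vertex-disjoint graphs $G_1,G_2$, the join $G_1\vee G_2$ has vertex set $V(G_1)\cup V(G_2)$ and edge set $E(G_1)\cup E(G_2)\cup\{v_1v_2: v_1\in V(G_1),v_2\in V(G_2)\}$. $K_s$ is the complete graph on $s$ vertices, and $G\vee K_0=G$. A cover of a graph $G$ is an ordered pair $\mathcal{H}=(L,H)$, where $H$ is a graph and $L$ is a mapping from $V(G)$ to the power set of $V(H)$ such that: (1) the sets $L(u)$, $u\in V(G)$, partition $V(H)$; (2) for every $u\in V(G)$, the induced subgraph $H[L(u)]$ is complete; (3) if $u\ne v$ are not adjacent in $G$, then there are no edges of $H$ between $L(u)$ and $L(v)$; (4) for each edge $uv\in E(G)$, the set of edges of $H$ between $L(u)$ and $L(v)$ is a (not necessarily perfect, possibly empty) matching. The cover is $r$-fold if $|L(v)|=r$ for all $v\in V(G)$. An $\mathcal{H}$-coloring of $G$ is an independent set in $H$ of size $|V(G)|$; $G$ is $\mathcal{H}$-colorable if it has an $\mathcal{H}$-coloring. The DP-chromatic number $\chi_{DP}(G)$ is the minimum positive integer $r$ such that $G$ is $\mathcal{H}$-colorable for each $r$-fold cover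 $\mathcal{H}$ of $G$. For a graph $G$, $Z_{DP}(G)=\min\{s\in\mathbb{N}: \chi_{DP}(G\vee K_s)=\chi(G\vee K_s)\}$. *)

theory Defs
  imports Complex_Main "HOL-Library.Ramsey" "HOL-Library.Disjoint_Sets"
begin

record 'a ugraph =
  verts :: "'a set"
  edges :: "'a set set"

text \<open>The null graph counts as a graph here, so that \<open>K\<^sub>0\<close> is available.\<close>

definition fin_graph :: "'a ugraph \<Rightarrow> bool" where
  "fin_graph G \<longleftrightarrow> finite (verts G) \<and> edges G \<subseteq> [verts G]\<^bsup>2\<^esup>"

definition complete_graph :: "nat \<Rightarrow> nat ugraph" where
  "complete_graph s = \<lparr>verts = {..<s}, edges = [{..<s}]\<^bsup>2\<^esup>\<rparr>"

text \<open>Only meant for \<open>n \<ge> 3\<close>.\<close>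

definition cycle_graph :: "nat \<Rightarrow> nat ugraph" where
  "cycle_graph n = \<lparr>verts = {..<n}, edges = {{i, Suc i mod n} |i. i < n}\<rparr>"

definition graph_iso :: "'a ugraph \<Rightarrow> 'b ugraph \<Rightarrow> bool" where
  "graph_iso G H \<longleftrightarrow>
     (\<exists>f. bij_betw f (verts G) (verts H) \<and>
          (\<forall>u\<in>verts G. \<forall>v\<in>verts G. {u, v} \<in> edges G \<longleftrightarrow> {f u, f v} \<in> edges H))"

text \<open>The sum type makes the two vertex sets disjoint; in particular the join with
  \<open>K\<^sub>0\<close> is \<open>G\<close> with its vertices relabelled by \<open>Inl\<close>.\<close>

definition join :: "'a ugraph \<Rightarrow> 'b ugraph \<Rightarrow> ('a + 'b) ugraph" where
  "join G H =
     \<lparr>verts = verts G <+> verts H,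
      edges = (`) Inl ` edges G \<union> (`) Inr ` edges H \<union>
              {{Inl u, Inr v} |u v. u \<in> verts G \<and> v \<in> verts H}\<rparr>"

definition colorable :: "'a ugraph \<Rightarrow> nat \<Rightarrow> bool" where
  "colorable G k \<longleftrightarrow>
     (\<exists>c :: 'a \<Rightarrow> nat. c ` verts G \<subseteq> {..<k} \<and> (\<forall>u v. {u, v} \<in> edges G \<longrightarrow> c u \<noteq> c v))"

definition chromatic_number :: "'a ugraph \<Rightarrow> nat" where
  "chromatic_number G = (LEAST k. colorable G k)"

definition edges_between :: "'b ugraph \<Rightarrow> 'b set \<Rightarrow> 'b set \<Rightarrow> 'b set set" where
  "edges_between H A B = {{x, y} |x y. x \<in> A \<and> y \<in> B \<and> {x, y} \<in> edges H}"

definition is_cover :: "'a ugraph \<Rightarrow> ('a \<Rightarrow> 'b set) \<Rightarrow> 'b ugraph \<Rightarrow> bool" where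
  "is_cover G L H \<longleftrightarrow>
     fin_graph H \<and>
     (\<Union>u\<in>verts G. L u) = verts H \<and> disjoint_family_on L (verts G) \<and>
     (\<forall>u\<in>verts G. clique (L u) (edges H)) \<and>
     (\<forall>u\<in>verts G. \<forall>v\<in>verts G. u \<noteq> v \<and> {u, v} \<notin> edges G \<longrightarrow> edges_between H (L u) (L v) = {}) \<and>
     (\<forall>u\<in>verts G. \<forall>v\<in>verts G. {u, v} \<in> edges G \<longrightarrow> disjoint (edges_between H (L u) (L v)))"

definition fold_cover :: "nat \<Rightarrow> 'a ugraph \<Rightarrow> ('a \<Rightarrow> 'b set) \<Rightarrow> 'b ugraph \<Rightarrow> bool" where
  "fold_cover r G L H \<longleftrightarrow> is_cover G L H \<and> (\<forall>v\<in>verts G. card (L v) = r)"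

definition cover_colorable :: "'a ugraph \<Rightarrow> 'b ugraph \<Rightarrow> bool" where
  "cover_colorable G H \<longleftrightarrow>
     (\<exists>I \<subseteq> verts H. indep I (edges H) \<and> card I = card (verts G))"

text \<open>Quantification over types inside a formula is impossible, so covers are taken with
  \<open>verts H\<close> a set of natural numbers. As \<open>H\<close> is finite this loses nothing;
  see \<open>DP_fold_colorable_cover\<close> below.\<close>

definition DP_fold_colorable :: "'a ugraph \<Rightarrow> nat \<Rightarrow> bool" where
  "DP_fold_colorable G r \<longleftrightarrow>
     (\<forall>(L :: 'a \<Rightarrow> nat set) (H :: nat ugraph). fold_cover r G L H \<longrightarrow> cover_colorable G H)"

definition DP_chromatic_number :: "'a ugraph \<Rightarrow> nat" where
  "DP_chromatic_number G = (LEAST r. 0 < r \<and> DP_fold_colorable G r)"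

definition Z_DP :: "'a ugraph \<Rightarrow> nat" where
  "Z_DP G =
     (LEAST s. DP_chromatic_number (join G (complete_graph s)) =
               chromatic_number (join G (complete_graph s)))"

lemma DP_fold_colorable_cover:
  fixes G :: "'a ugraph" and L :: "'a \<Rightarrow> 'b set" and H :: "'b ugraph"
  assumes DP: "DP_fold_colorable G r" and cov: "fold_cover r G L H"
  shows "cover_colorable G H"
proof -
  have H: "finite (verts H)" "edges H \<subseteq> [verts H]\<^bsup>2\<^esup>" and U: "(\<Union>u\<in>verts G. L u) = verts H"
    using cov by (auto simp: fold_cover_def is_cover_def fin_graph_def)
  obtain f :: "'b \<Rightarrow> nat" where f: "inj_on f (verts H)"
    using finite_imp_inj_to_nat_seg[OF H(1)] by blast
  define L' where "L' u = f ` L u" for u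
  define H' where "H' = \<lparr>verts = f ` verts H, edges = (`) f ` edges H\<rparr>"
  have LV: "L u \<subseteq> verts H" if "u \<in> verts G" for u using U that by blast
  have eV: "e \<subseteq> verts H" if "e \<in> edges H" for e
    using H(2) that by (auto simp: nsets_def)
  have edge_iff: "{f x, f y} \<in> edges H' \<longleftrightarrow> {x, y} \<in> edges H" if "x \<in> verts H" "y \<in> verts H" for x y
  proof
    assume "{f x, f y} \<in> edges H'"
    then obtain e where e: "e \<in> edges H" "f ` {x, y} = f ` e" by (auto simp: H'_def)
    then have "{x, y} = e" using f eV[OF e(1)] that by (metis inj_on_image_eq_iff empty_subsetI insert_subset)
    then show "{x, y} \<in> edges H" using e by simp
  next
    assume "{x, y} \<in> edges H"
    then have "f ` {x, y} \<in> edges H'" unfolding H'_def by (simp only: ugraph.simps) (rule imageI)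
    then show "{f x, f y} \<in> edges H'" by simp
  qed
  have between: "edges_between H' (L' u) (L' v) = (`) f ` edges_between H (L u) (L v)" (is "?A = ?B")
    if uv: "u \<in> verts G" "v \<in> verts G" for u v
  proof
    show "?A \<subseteq> ?B"
    proof
      fix e assume "e \<in> ?A"
      then obtain x y where xy: "x \<in> L u" "y \<in> L v" "e = {f x, f y}" "{f x, f y} \<in> edges H'"
        by (auto simp: edges_between_def L'_def)
      then have "{x, y} \<in> edges H" using edge_iff LV uv by blast
      then have "{x, y} \<in> edges_between H (L u) (L v)"
        using xy(1,2) unfolding edges_between_def by blast
      then show "e \<in> ?B" using xy(3) by (intro image_eqI[of _ _ "{x, y}"]) auto
    qed
    show "?B \<subseteq> ?A"
    proof
      fix e assume "e \<in> ?B"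
      then obtain x y where xy: "x \<in> L u" "y \<in> L v" "e = {f x, f y}" "{x, y} \<in> edges H"
        by (auto simp: edges_between_def)
      then have "{f x, f y} \<in> edges H'" using edge_iff LV uv by blast
      then show "e \<in> ?A" using xy(1-3) unfolding edges_between_def L'_def by blast
    qed
  qed
  have disj_img: "f ` A \<inter> f ` B = {}" if "A \<inter> B = {}" "A \<subseteq> verts H" "B \<subseteq> verts H" for A B
    using inj_on_image_Int[OF f that(2,3)] that(1) by simp
  have "fin_graph H'"
  proof -
    have "f ` e \<in> [f ` verts H]\<^bsup>2\<^esup>" if "e \<in> edges H" for e
    proof -
      have "e \<subseteq> verts H" "finite e" "card e = 2" using H(2) that by (auto simp: nsets_def)
      then show ?thesis using card_image[OF inj_on_subset[OF f]] by (auto simp: nsets_def)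
    qed
    then show ?thesis using H by (auto simp: fin_graph_def H'_def)
  qed
  moreover have "(\<Union>u\<in>verts G. L' u) = verts H'"
    unfolding L'_def H'_def by (simp only: ugraph.simps U[symmetric] image_UN)
  moreover have "disjoint_family_on L' (verts G)"
    unfolding disjoint_family_on_def L'_def
  proof (intro ballI impI)
    fix u v assume uv: "u \<in> verts G" "v \<in> verts G" "u \<noteq> v"
    have "disjoint_family_on L (verts G)" using cov by (simp add: fold_cover_def is_cover_def)
    from disjoint_family_onD[OF this uv] show "f ` L u \<inter> f ` L v = {}"
      by (rule disj_img) (use LV uv in auto)
  qed
  moreover have "clique (L' u) (edges H')" if u: "u \<in> verts G" for u
  proof -
    have "clique (L u) (edges H)" using cov u by (auto simp: fold_cover_def is_cover_def)
    then have "{f x, f y} \<in> edges H'" if "x \<in> L u" "y \<in> L u" "x \<noteq> y" for x y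
      using that LV[OF u] edge_iff[of x y] by (auto simp: clique_def)
    then show ?thesis by (auto simp: L'_def clique_def)
  qed
  moreover have "edges_between H' (L' u) (L' v) = {}"
    if "u \<in> verts G" "v \<in> verts G" "u \<noteq> v \<and> {u, v} \<notin> edges G" for u v
    using cov that between[of u v] by (simp add: fold_cover_def is_cover_def)
  moreover have "disjoint (edges_between H' (L' u) (L' v))"
    if uv: "u \<in> verts G" "v \<in> verts G" "{u, v} \<in> edges G" for u v
  proof -
    have d: "disjoint (edges_between H (L u) (L v))"
      using cov uv by (auto simp: fold_cover_def is_cover_def)
    have sub: "e \<subseteq> verts H" if "e \<in> edges_between H (L u) (L v)" for e
      using that eV by (auto simp: edges_between_def)
    show ?thesis unfolding between[OF uv(1,2)]
    proof (rule disjointI)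
      fix a b assume "a \<in> (`) f ` edges_between H (L u) (L v)" "b \<in> (`) f ` edges_between H (L u) (L v)"
        and ne: "a \<noteq> b"
      then obtain e e' where e: "a = f ` e" "b = f ` e'" "e \<in> edges_between H (L u) (L v)"
        "e' \<in> edges_between H (L u) (L v)" by auto
      then have "e \<inter> e' = {}" using d ne by (metis disjointD)
      then show "a \<inter> b = {}" using disj_img[of e e'] sub e by simp
    qed
  qed
  moreover have "card (L' v) = r" if "v \<in> verts G" for v
    using cov card_image[OF inj_on_subset[OF f LV[OF that]]] that by (auto simp: fold_cover_def L'_def)
  ultimately have "fold_cover r G L' H'"
    unfolding fold_cover_def is_cover_def by simp
  then have "cover_colorable G H'" using DP unfolding DP_fold_colorable_def by blast
  then obtain I' where I': "I' \<subseteq> f ` verts H" "indep I' (edges H')" "card I' = card (verts G)"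
    by (auto simp: cover_colorable_def H'_def)
  obtain I where I: "I \<subseteq> verts H" "I' = f ` I" using I'(1) by (meson subset_imageE)
  have "indep I (edges H)"
    unfolding indep_def
  proof (intro ballI impI)
    fix x y assume xy: "x \<in> I" "y \<in> I" "x \<noteq> y"
    then have "f x \<noteq> f y" using f I(1) by (meson inj_onD subsetD)
    then have "{f x, f y} \<notin> edges H'" using I'(2) xy I(2) unfolding indep_def by blast
    then show "{x, y} \<notin> edges H" using edge_iff[of x y] xy I(1) by auto
  qed
  moreover have "card I = card (verts G)"
    using I'(3) I card_image[OF inj_on_subset[OF f I(1)]] by simp
  ultimately show ?thesis using I(1) unfolding cover_colorable_def by blast
qed

end

theory Submission
  imports Defs
begin

text \<open>
  Colouring a join with \<open>K\<^sub>s\<close> takes exactly \<open>s\<close> further colours, and a DP-chromatic number is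
  never below the chromatic number. Hence \<^const>\<open>Z_DP\<close> of a graph \<open>G\<close> with chromatic number \<open>k\<close>
  is the least \<open>s\<close> for which every \<open>(k + s)\<close>-fold cover of \<open>G \<or> K\<^sub>s\<close> has a colouring
  (\<open>Z_DP_eq_Least\<close>). A cover is handled as a family of lists with a symmetric conflict
  relation \<open>E\<close> on colours, and a colouring is a \<^emph>\<open>transversal\<close>: a conflict-free choice from the lists.

  \<^bold>\<open>The general bound.\<close> Already \<open>s = 2 m\<close> suffices, and \<open>2 m\<close> is at most the bound claimed.
  Let \<open>A\<close> consist of the \<open>s\<close> new vertices and let \<open>U\<close> be the vertex set of \<open>G\<close>. A vertex \<open>u\<close> of
  \<open>U\<close> may be coloured last if its list is longer than \<open>deg\<^sub>U u + |A|\<close>; the \<open>demand\<close> of \<open>u\<close> is the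
  number of colours it lacks for that. With lists of size \<open>k + s\<close> the demand of \<open>u\<close> is at most its
  degree, so the total demand is at most \<open>2 m \<le> |A|\<close>. The core of the proof,
  \<open>transversal_of_demand_le\<close>, says that a total demand of at most \<open>|A|\<close> is harmless if \<open>U\<close> has a
  proper colouring with \<open>k\<close> colours and the lists on \<open>A\<close> have at least \<open>|A| + k\<close> members.

  That theorem is proved by induction on \<open>|A| + |U|\<close>. Colouring a set \<open>B\<close> of vertices of \<open>A\<close>
  spends \<open>|B|\<close> units of the budget \<open>|A|\<close>. The demand of \<open>u\<close> then falls by \<open>|B|\<close> minus the number
  of colours that \<open>u\<close> loses; the difference, the \<open>gain\<close> at \<open>u\<close>, is positive when two vertices of
  \<open>B\<close> forbid the same colour of \<open>u\<close>. If the gains sum to \<open>|B|\<close> or more, \<open>B\<close> has paid for itself and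
  induction applies. Otherwise take a largest set \<open>B\<close> that is a single unit short. Adding a
  further vertex that forbids, at some \<open>v\<close>, a colour which \<open>B\<close> forbids already makes the set pay,
  or it satisfies \<open>v\<close> completely, and then colouring \<open>v\<close> last saves the missing unit
  (\<open>transversal_of_extension\<close>). If there is no such vertex (\<open>transversal_of_stuck\<close>), then one
  vertex \<open>b\<close> of \<open>B\<close> is given up: its colour \<open>x\<close> is replaced by the colours that it forbids on a whole
  colour class \<open>W\<close> of \<open>U\<close>. The colours on \<open>W\<close> are conflict-free since \<open>W\<close> is independent, they
  forbid hardly anything on \<open>A\<close> because \<open>B\<close> is stuck, and \<open>U\<close> now needs one colour
  class fewer.

  \<^bold>\<open>The remaining cases.\<close> If \<open>k \<le> 1\<close> or \<open>n \<le> k + 2\<close>, then \<open>G\<close> itself has a colouring from every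
  \<open>k\<close>-fold cover, with one exception. The only case that greedy colouring does not settle is
  \<open>n = k + 2\<close> with pairwise disjoint non-adjacent pairs. There are at least two of them, and colouring
  all but one of the vertices outside these two greedily leaves a wheel with four spokes and lists of size three
  (\<open>transversal_wheel\<close>). If the wheel had no transversal, all its matchings would be perfect and, read
  through the hub, all would be the identity; but then the proper 3-colouring of the wheel is a
  transversal. When no vertex is left to serve as hub, the graph is the four-cycle: the 2-fold cover
  with a single twisted matching has no colouring, whereas the join with \<open>K\<^sub>1\<close> is that wheel.
\<close>

section \<open>Covers as conflict relations\<close>

text \<open>
  The lists need not be disjoint and edges inside a list are not recorded, since a transversal picks
  one colour per vertex. This makes it possible to shrink the lists and the vertex set freely.
\<close>
definition cover_on :: "('v \<Rightarrow> 'v \<Rightarrow> bool) \<Rightarrow> 'v set \<Rightarrow> ('v \<Rightarrow> 'c set) \<Rightarrow> ('c \<Rightarrow> 'c \<Rightarrow> bool) \<Rightarrow> bool" where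
  "cover_on adj V L E \<longleftrightarrow>
     finite V \<and> (\<forall>v\<in>V. finite (L v)) \<and> symp E \<and>
     (\<forall>p\<in>V. \<forall>q\<in>V. p \<noteq> q \<longrightarrow> (\<forall>x\<in>L p. \<forall>y\<in>L q. \<forall>y'\<in>L q. E x y \<longrightarrow> E x y' \<longrightarrow> y = y')) \<and>
     (\<forall>p\<in>V. \<forall>q\<in>V. p \<noteq> q \<longrightarrow> \<not> adj p q \<longrightarrow> (\<forall>x\<in>L p. \<forall>y\<in>L q. \<not> E x y))"

definition transversal :: "'v set \<Rightarrow> ('v \<Rightarrow> 'c set) \<Rightarrow> ('c \<Rightarrow> 'c \<Rightarrow> bool) \<Rightarrow> ('v \<Rightarrow> 'c) \<Rightarrow> bool" where
  "transversal V L E f \<longleftrightarrow> (\<forall>v\<in>V. f v \<in> L v) \<and> (\<forall>p\<in>V. \<forall>q\<in>V. p \<noteq> q \<longrightarrow> \<not> E (f p) (f q))"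

text \<open>
  The colours that stay available at \<open>v\<close> once the vertices in \<open>C\<close> are coloured by \<open>f\<close>; the others
  are the \<open>killed\<close> ones.
\<close>
definition residual :: "('v \<Rightarrow> 'c set) \<Rightarrow> ('c \<Rightarrow> 'c \<Rightarrow> bool) \<Rightarrow> 'v set \<Rightarrow> ('v \<Rightarrow> 'c) \<Rightarrow> 'v \<Rightarrow> 'c set" where
  "residual L E C f v = {x \<in> L v. \<forall>c\<in>C. \<not> E (f c) x}"

definition killed :: "('v \<Rightarrow> 'c set) \<Rightarrow> ('c \<Rightarrow> 'c \<Rightarrow> bool) \<Rightarrow> 'v set \<Rightarrow> ('v \<Rightarrow> 'c) \<Rightarrow> 'v \<Rightarrow> 'c set" where
  "killed L E C f v = {x \<in> L v. \<exists>c\<in>C. E (f c) x}"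

lemma cover_onD:
  assumes "cover_on adj V L E"
  shows "finite V" "\<And>v. v \<in> V \<Longrightarrow> finite (L v)" "\<And>x y. E x y \<Longrightarrow> E y x"
    and "\<And>p q x y y'. \<lbrakk>p \<in> V; q \<in> V; p \<noteq> q; x \<in> L p; y \<in> L q; y' \<in> L q; E x y; E x y'\<rbrakk> \<Longrightarrow> y = y'"
    and "\<And>p q x y. \<lbrakk>p \<in> V; q \<in> V; p \<noteq> q; x \<in> L p; y \<in> L q; E x y\<rbrakk> \<Longrightarrow> adj p q"
proof -
  show "finite V" "\<And>v. v \<in> V \<Longrightarrow> finite (L v)" "\<And>x y. E x y \<Longrightarrow> E y x"
    using assms by (simp_all add: cover_on_def symp_def)
  have 4: "\<forall>p\<in>V. \<forall>q\<in>V. p \<noteq> q \<longrightarrow> (\<forall>x\<in>L p. \<forall>y\<in>L q. \<forall>y'\<in>L q. E x y \<longrightarrow> E x y' \<longrightarrow> y = y')"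
    and 5: "\<forall>p\<in>V. \<forall>q\<in>V. p \<noteq> q \<longrightarrow> \<not> adj p q \<longrightarrow> (\<forall>x\<in>L p. \<forall>y\<in>L q. \<not> E x y)"
    using assms by (simp_all add: cover_on_def)
  show "\<lbrakk>p \<in> V; q \<in> V; p \<noteq> q; x \<in> L p; y \<in> L q; y' \<in> L q; E x y; E x y'\<rbrakk> \<Longrightarrow> y = y'" for p q x y y'
    using 4 by metis
  show "\<lbrakk>p \<in> V; q \<in> V; p \<noteq> q; x \<in> L p; y \<in> L q; E x y\<rbrakk> \<Longrightarrow> adj p q" for p q x y
    using 5 by metis
qed

lemma cover_on_mono:
  assumes "cover_on adj V L E" "V' \<subseteq> V" "\<And>v. v \<in> V' \<Longrightarrow> L' v \<subseteq> L v"
  shows "cover_on adj V' L' E"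
proof -
  note c = cover_onD[OF assms(1)]
  have mem: "p \<in> V" "x \<in> L p" if "p \<in> V'" "x \<in> L' p" for p x
    using that assms(2,3) by blast+
  have sub: "p \<in> V" if "p \<in> V'" for p using that assms(2) by blast
  show ?thesis
    unfolding cover_on_def symp_def
  proof (intro conjI ballI impI allI)
    show "finite V'" using c(1) assms(2) finite_subset by blast
    show "finite (L' v)" if "v \<in> V'" for v using c(2)[OF sub[OF that]] assms(3)[OF that] finite_subset by blast
    show "E y x" if "E x y" for x y using that by (rule c(3))
    show "y = y'" if "p \<in> V'" "q \<in> V'" "p \<noteq> q" "x \<in> L' p" "y \<in> L' q" "y' \<in> L' q" "E x y" "E x y'" for p q x y y'
      using that by (intro c(4)[of p q x y y'] mem sub)
    show "\<not> E x y" if "p \<in> V'" "q \<in> V'" "p \<noteq> q" "\<not> adj p q" "x \<in> L' p" "y \<in> L' q" for p q x y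
      using c(5)[of p q x y] mem[OF that(1,5)] mem[OF that(2,6)] that(3,4) by blast
  qed
qed

lemma cover_on_residual:
  assumes "cover_on adj V L E" "V' \<subseteq> V"
  shows "cover_on adj V' (residual L E C f) E"
  using assms by (rule cover_on_mono) (auto simp: residual_def)

text \<open>
  Colouring part of the graph reduces the problem to the residual lists on the rest.
\<close>
lemma transversal_extend:
  assumes "cover_on adj V L E" "C \<subseteq> V" "V - C = V'" "transversal C L E f" "transversal V' (residual L E C f) E g"
  shows "\<exists>h. transversal V L E h"
proof -
  have 1: "f v \<in> L v" if "v \<in> C" for v using assms(4) that by (simp add: transversal_def)
  have 2: "g v \<in> L v" "\<forall>c\<in>C. \<not> E (f c) (g v)" if "v \<in> V" "v \<notin> C" for v
    using assms(3,5) that by (auto simp: transversal_def residual_def)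
  have 3: "\<not> E (g v) (f c)" if "v \<in> V" "v \<notin> C" "c \<in> C" for v c
    using 2(2)[OF that(1,2)] that(3) cover_onD(3)[OF assms(1)] by blast
  have 4: "\<not> E (f c) (f d)" if "c \<in> C" "d \<in> C" "c \<noteq> d" for c d
    using assms(4) that by (simp add: transversal_def)
  have 5: "\<not> E (g c) (g d)" if "c \<in> V - C" "d \<in> V - C" "c \<noteq> d" for c d
    using assms(3,5) that by (simp add: transversal_def)
  have "transversal V L E (\<lambda>v. if v \<in> C then f v else g v)"
    unfolding transversal_def using 1 2 3 4 5 by simp
  then show ?thesis by blast
qed

text \<open>
  Lists are joined by matchings, so each coloured neighbour kills at most one colour.
\<close>
lemma card_killed_le:
  assumes "cover_on adj V L E" "insert v C \<subseteq> V" "v \<notin> C" "\<And>c. c \<in> C \<Longrightarrow> f c \<in> L c"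
  shows "card (killed L E C f v) \<le> card {c \<in> C. adj c v}"
proof -
  note c = cover_onD[OF assms(1)]
  let ?D = "{c \<in> C. \<exists>x\<in>L v. E (f c) x}"
  have fin: "finite C" using c(1) assms(2) finite_subset by auto
  have "killed L E C f v \<subseteq> (\<lambda>c. SOME x. x \<in> L v \<and> E (f c) x) ` ?D"
  proof
    fix x assume "x \<in> killed L E C f v"
    then obtain b where b: "b \<in> C" "x \<in> L v" "E (f b) x" by (auto simp: killed_def)
    let ?y = "SOME x. x \<in> L v \<and> E (f b) x"
    have "?y \<in> L v \<and> E (f b) ?y" by (rule someI[of _ x]) (use b in auto)
    then have "?y = x" using c(4)[of b v "f b" ?y x] b assms(2-4) by auto
    then show "x \<in> (\<lambda>c. SOME x. x \<in> L v \<and> E (f c) x) ` ?D" using b by (intro image_eqI[of _ _ b]) auto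
  qed
  then have "card (killed L E C f v) \<le> card ?D"
    using fin surj_card_le[of ?D "killed L E C f v"] by simp
  also have "\<dots> \<le> card {c \<in> C. adj c v}"
    by (rule card_mono) (use fin c(5) assms in \<open>auto, metis insert_subset subsetD\<close>)
  finally show ?thesis .
qed

lemma killed_mono: "B \<subseteq> C \<Longrightarrow> killed L E B f v \<subseteq> killed L E C f v"
  by (auto simp: killed_def)

lemma card_residual:
  assumes "finite (L v)"
  shows "card (L v) = card (residual L E C f v) + card (killed L E C f v)"
proof -
  have "L v = residual L E C f v \<union> killed L E C f v" "residual L E C f v \<inter> killed L E C f v = {}"
    by (auto simp: residual_def killed_def)
  then show ?thesis using assms by (metis card_Un_disjoint finite_Un)
qed

lemma transversal_extend_last:
  assumes "cover_on adj V L E" "v \<in> V" "transversal (V - {v}) L E g" "card {w \<in> V - {v}. adj w v} < card (L v)"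
  shows "\<exists>h. transversal V L E h"
proof -
  note c = cover_onD[OF assms(1)]
  have "card (killed L E (V - {v}) g v) < card (L v)"
    using card_killed_le[OF assms(1), of v "V - {v}" g] assms(2-4) unfolding transversal_def by fastforce
  then have "card (residual L E (V - {v}) g v) \<noteq> 0"
    using card_residual[of L v E "V - {v}" g] c(2)[OF assms(2)] by linarith
  then obtain x where "x \<in> residual L E (V - {v}) g v" by (metis card.empty ex_in_conv)
  then have "transversal {v} (residual L E (V - {v}) g) E (\<lambda>_. x)" by (auto simp: transversal_def)
  then show ?thesis
    using transversal_extend[OF assms(1), of "V - {v}" "{v}" g] assms(2,3) by auto
qed

lemma transversal_greedy:
  assumes "cover_on adj V L E" "\<And>v. v \<in> V \<Longrightarrow> card V \<le> card (L v)"
  shows "\<exists>h. transversal V L E h"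
proof -
  have "finite W \<Longrightarrow> W \<subseteq> V \<Longrightarrow> \<exists>h. transversal W L E h" for W
  proof (induction W rule: finite_induct)
    case empty
    then show ?case by (auto simp: transversal_def)
  next
    case (insert w W)
    then obtain h where h: "transversal W L E h" by auto
    have cov: "cover_on adj (insert w W) L E" using cover_on_mono[OF assms(1) insert.prems] by simp
    have "card {u \<in> insert w W - {w}. adj u w} \<le> card W"
      by (rule card_mono) (use insert in auto)
    also have "\<dots> < card (insert w W)" using insert by simp
    also have "\<dots> \<le> card V" using insert.prems cover_onD(1)[OF assms(1)] by (rule card_mono[rotated])
    also have "\<dots> \<le> card (L w)" using assms(2) insert.prems by auto
    finally show ?case
      using transversal_extend_last[OF cov, of w h] h insert.hyps by auto
  qed
  then show ?thesis using cover_onD(1)[OF assms(1)] by auto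
qed

text \<open>
  Each element of \<open>B\<close> beyond the first in its fibre accounts for at most two colliding elements:
  itself and the one it meets first.
\<close>
lemma card_colliding_le:
  assumes "finite B"
  shows "card {b \<in> B. \<exists>b'\<in>B. b' \<noteq> b \<and> h b = h b'} + 2 * card (h ` B) \<le> 2 * card B"
  using assms
proof (induction B rule: finite_induct)
  case empty
  then show ?case by simp
next
  case (insert c B)
  let ?coll = "\<lambda>B. {b \<in> B. \<exists>b'\<in>B. b' \<noteq> b \<and> h b = h b'}"
  show ?case
  proof (cases "h c \<in> h ` B")
    case False
    then have "?coll (insert c B) = ?coll B" using insert.hyps by (auto simp: image_iff)
    then show ?thesis using insert False by (simp add: card_insert_if)
  next
    case True
    then obtain c' where c': "c' \<in> B" "h c' = h c" by auto
    have "?coll (insert c B) \<subseteq> insert c (insert c' (?coll B))"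
    proof
      fix x assume x: "x \<in> ?coll (insert c B)"
      then obtain b' where b': "b' \<in> insert c B" "b' \<noteq> x" "h x = h b'" by blast
      show "x \<in> insert c (insert c' (?coll B))"
      proof (cases "x = c \<or> x = c'")
        case False
        then have "x \<in> B" "\<exists>b''\<in>B. b'' \<noteq> x \<and> h x = h b''"
          using x b' c' by (auto intro: bexI[of _ b'] bexI[of _ c'])
        then show ?thesis by simp
      qed auto
    qed
    then have "card (?coll (insert c B)) \<le> card (insert c (insert c' (?coll B)))"
      using insert.hyps by (intro card_mono) auto
    also have "\<dots> \<le> card (?coll B) + 2"
      using insert.hyps by (simp add: card_insert_if)
    finally show ?thesis using insert True by (simp add: insert_absorb)
  qed
qed

section \<open>Bounded total demand gives a transversal\<close>

text \<open>
  How far \<open>u\<close> is from being colourable after everything else: its list should exceed the number of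
  its potential neighbours, all of \<open>A\<close> included. The subtraction is truncated, so demand zero
  means that \<open>u\<close> can safely be postponed.
\<close>
definition demand :: "('v \<Rightarrow> 'v \<Rightarrow> bool) \<Rightarrow> 'v set \<Rightarrow> 'v set \<Rightarrow> ('v \<Rightarrow> 'c set) \<Rightarrow> 'v \<Rightarrow> nat" where
  "demand adj A U L u = card {w \<in> U. adj u w} + card A + 1 - card (L u)"

lemma transversal_extend_saturated:
  assumes "cover_on adj (A \<union> U) L E" "A \<inter> U = {}" "symp adj" "u \<in> U" "\<not> adj u u"
    and "demand adj A U L u = 0" "transversal (A \<union> (U - {u})) L E g"
  shows "\<exists>h. transversal (A \<union> U) L E h"
proof -
  have fin: "finite A" "finite U" using cover_onD(1)[OF assms(1)] by auto
  have "{w \<in> A \<union> U - {u}. adj w u} \<subseteq> A \<union> {w \<in> U. adj u w}"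
    using assms(3) by (auto dest: sympD)
  then have "card {w \<in> A \<union> U - {u}. adj w u} \<le> card (A \<union> {w \<in> U. adj u w})"
    using fin by (intro card_mono) auto
  also have "\<dots> \<le> card A + card {w \<in> U. adj u w}" by (rule card_Un_le)
  also have "\<dots> < card (L u)" using assms(6) by (simp add: demand_def)
  finally have "card {w \<in> A \<union> U - {u}. adj w u} < card (L u)" .
  moreover have "A \<union> U - {u} = A \<union> (U - {u})" using assms(2,4) by auto
  ultimately show ?thesis
    using transversal_extend_last[OF assms(1), of u g] assms(4,7) by auto
qed

text \<open>
  Removing \<open>B\<close> from \<open>A\<close> takes \<open>|B|\<close> off the demand, and each killed colour gives one back. The
  second alternative absorbs the truncation at zero.
\<close>
lemma demand_residual_le:
  assumes "cover_on adj (A \<union> U) L E" "u \<in> U" "B \<subseteq> A" "card (killed L E B f u) \<le> card B"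
  shows "demand adj (A - B) U (residual L E B f) u + (card B - card (killed L E B f u)) \<le> demand adj A U L u
    \<or> demand adj (A - B) U (residual L E B f) u = 0"
proof -
  note c = cover_onD[OF assms(1)]
  have "card (A - B) = card A - card B" "card B \<le> card A"
    using assms(3) c(1) by (auto simp: card_Diff_subset finite_subset card_mono)
  moreover have "card (L u) = card (residual L E B f u) + card (killed L E B f u)"
    using c(2) assms(2) by (intro card_residual) auto
  ultimately show ?thesis using assms(4) unfolding demand_def by linarith
qed

text \<open>
  The situation in the inductive step of \<open>transversal_of_demand_le\<close>: an instance of that theorem
  together with its induction hypothesis \<open>smaller\<close>.
\<close>
locale demand_instance =
  fixes adj :: "'v \<Rightarrow> 'v \<Rightarrow> bool" and E :: "'c \<Rightarrow> 'c \<Rightarrow> bool" and col :: "'v \<Rightarrow> nat"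
    and A U :: "'v set" and L :: "'v \<Rightarrow> 'c set" and k :: nat
  assumes sym: "symp adj" and cov: "cover_on adj (A \<union> U) L E" and disj: "A \<inter> U = {}"
    and proper: "\<forall>u\<in>U. \<forall>w\<in>U. adj u w \<longrightarrow> col u \<noteq> col w" and colors: "card (col ` U) \<le> k"
    and lists_A: "\<forall>a\<in>A. card A + k \<le> card (L a)"
    and demands: "(\<Sum>u\<in>U. demand adj A U L u) \<le> card A"
    and smaller: "\<And>A' U' L' k'. \<lbrakk>cover_on adj (A' \<union> U') L' E; A' \<subseteq> A; U' \<subseteq> U; A' \<union> U' \<noteq> A \<union> U; card (col ` U') \<le> k';
        \<forall>a\<in>A'. card A' + k' \<le> card (L' a); (\<Sum>u\<in>U'. demand adj A' U' L' u) \<le> card A'\<rbrakk>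
      \<Longrightarrow> \<exists>h. transversal (A' \<union> U') L' E h"
begin

lemmas cover = cover_onD[OF cov]

lemma fin: "finite A" "finite U"
  using cover(1) by auto

lemma irrefl: "u \<in> U \<Longrightarrow> \<not> adj u u"
  using proper by blast

lemma finite_subset_A: "B \<subseteq> A \<Longrightarrow> finite B"
  using fin finite_subset by blast

lemma transversal_of_residual:
  assumes "C \<subseteq> A \<union> U" "C \<noteq> {}" "transversal C L E f" "A' = A - C" "U' = U - C" "card (col ` U') \<le> k'"
    "\<forall>a\<in>A'. card A' + k' \<le> card (residual L E C f a)"
    "(\<Sum>u\<in>U'. demand adj A' U' (residual L E C f) u) \<le> card A'"
  shows "\<exists>h. transversal (A \<union> U) L E h"
proof -
  have sub: "A' \<union> U' = A \<union> U - C" using assms(4,5) by auto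
  have "\<exists>h. transversal (A' \<union> U') (residual L E C f) E h"
  proof (rule smaller)
    show "cover_on adj (A' \<union> U') (residual L E C f) E"
      using cover_on_residual[OF cov] sub by auto
  qed (use assms sub in auto)
  then show ?thesis
    using transversal_extend[OF cov assms(1) sub[symmetric] assms(3)] by blast
qed

lemma card_residual_ge:
  assumes "B \<subseteq> A" "a \<in> A - B" "transversal B L E f"
  shows "card (L a) \<le> card (residual L E B f a) + card B"
proof -
  have "card (killed L E B f a) \<le> card {x \<in> B. adj x a}"
    by (rule card_killed_le[OF cov]) (use assms in \<open>auto simp: transversal_def\<close>)
  also have "\<dots> \<le> card B" using assms(1) fin by (intro card_mono) (auto intro: finite_subset)
  finally show ?thesis
    using card_residual[of L a E B f] cover(2)[of a] assms(2) by auto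
qed

text \<open>
  A vertex without demand is coloured last, after the induction hypothesis has coloured the rest.
\<close>
lemma transversal_of_saturated:
  assumes u: "u \<in> U" "demand adj A U L u = 0"
  shows "\<exists>h. transversal (A \<union> U) L E h"
proof -
  have "\<exists>h. transversal (A \<union> (U - {u})) L E h"
  proof (rule smaller)
    show "cover_on adj (A \<union> (U - {u})) L E" by (rule cover_on_mono[OF cov]) auto
    show "A \<union> (U - {u}) \<noteq> A \<union> U" using u disj by auto
    show "card (col ` (U - {u})) \<le> k"
      using colors card_mono[of "col ` U" "col ` (U - {u})"] fin by (meson Diff_subset finite_imageI image_mono le_trans)
    have "(\<Sum>w\<in>U - {u}. demand adj A (U - {u}) L w) \<le> (\<Sum>w\<in>U - {u}. demand adj A U L w)"
      unfolding demand_def using fin by (intro sum_mono diff_le_mono add_le_mono card_mono) auto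
    also have "\<dots> \<le> (\<Sum>w\<in>U. demand adj A U L w)" using fin by (intro sum_mono2) auto
    finally show "(\<Sum>w\<in>U - {u}. demand adj A (U - {u}) L w) \<le> card A" using demands by simp
  qed (use lists_A in auto)
  then show ?thesis
    using transversal_extend_saturated[OF cov disj sym u(1) irrefl[OF u(1)] u(2)] by blast
qed

text \<open>
  Giving \<open>a\<close> the colour \<open>x\<close> costs one unit of \<open>|A|\<close> and no vertex more than one colour, while \<open>u\<close>
  loses none, so the total demand falls by one as well.
\<close>
lemma transversal_of_unmatched:
  assumes a: "a \<in> A" "x \<in> L a" and u: "u \<in> U" "\<forall>y\<in>L u. \<not> E x y" and pos: "1 \<le> demand adj A U L u"
  shows "\<exists>h. transversal (A \<union> U) L E h"
proof -
  let ?f = "\<lambda>_::'v. x"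
  have tr: "transversal {a} L E ?f" using a by (auto simp: transversal_def)
  have killed1: "card (killed L E {a} ?f w) \<le> 1" if "w \<in> U" for w
  proof -
    have "card (killed L E {a} ?f w) \<le> card {x \<in> {a}. adj x w}"
      by (rule card_killed_le[OF cov]) (use that a disj in auto)
    also have "\<dots> \<le> card {a}" by (intro card_mono) auto
    finally show ?thesis by simp
  qed
  have le: "demand adj (A - {a}) U (residual L E {a} ?f) w \<le> demand adj A U L w" if "w \<in> U" for w
    using demand_residual_le[OF cov that, of "{a}" ?f] killed1[OF that] a by auto
  have "killed L E {a} ?f u = {}" using u by (auto simp: killed_def)
  then have "demand adj (A - {a}) U (residual L E {a} ?f) u + 1 \<le> demand adj A U L u"
    using demand_residual_le[OF cov u(1), of "{a}" ?f] pos a by auto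
  then have "(\<Sum>w\<in>U. demand adj (A - {a}) U (residual L E {a} ?f) w) < (\<Sum>w\<in>U. demand adj A U L w)"
    using fin le u(1) by (intro sum_strict_mono_ex1) (auto intro!: bexI[of _ u])
  moreover have cardA: "card (A - {a}) + 1 = card A" using card_Suc_Diff1[OF fin(1) a(1)] by linarith
  ultimately have "(\<Sum>w\<in>U. demand adj (A - {a}) U (residual L E {a} ?f) w) \<le> card (A - {a})"
    using demands by linarith
  moreover have "\<forall>b\<in>A - {a}. card (A - {a}) + k \<le> card (residual L E {a} ?f b)"
  proof
    fix b assume b: "b \<in> A - {a}"
    have "card (L b) \<le> card (residual L E {a} ?f b) + card {a}"
      by (rule card_residual_ge[OF _ b tr]) (use a in auto)
    moreover have "card A + k \<le> card (L b)" using lists_A b by auto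
    ultimately show "card (A - {a}) + k \<le> card (residual L E {a} ?f b)"
      using cardA by simp
  qed
  ultimately show ?thesis
    by (intro transversal_of_residual[OF _ _ tr refl _ colors]) (use a disj in auto)
qed

end

text \<open>
  What is left when the two easy reductions do not apply: each colour available in \<open>A\<close> kills exactly
  one colour at every vertex of \<open>U\<close>.
\<close>
locale matched_demand_instance = demand_instance adj E col A U L k
  for adj :: "'v \<Rightarrow> 'v \<Rightarrow> bool" and E :: "'c \<Rightarrow> 'c \<Rightarrow> bool" and col A U L k +
  assumes U: "U \<noteq> {}" and pos: "\<And>u. u \<in> U \<Longrightarrow> 1 \<le> demand adj A U L u"
    and matched: "\<And>a x u. a \<in> A \<Longrightarrow> x \<in> L a \<Longrightarrow> u \<in> U \<Longrightarrow> \<exists>y\<in>L u. E x y"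
begin

lemma colors_pos: "1 \<le> k"
  using U colors fin by (metis One_nat_def Suc_leI card_gt_0_iff finite_imageI image_is_empty le_trans)

lemma A_nonempty: "A \<noteq> {}"
proof -
  obtain u where "u \<in> U" using U by blast
  then have "1 \<le> (\<Sum>u\<in>U. demand adj A U L u)"
    using pos[of u] member_le_sum[of u U "demand adj A U L"] fin by fastforce
  then show ?thesis using demands by auto
qed

definition partner :: "'v \<Rightarrow> 'c \<Rightarrow> 'c" where
  "partner u x = (SOME y. y \<in> L u \<and> E x y)"

lemma partner: "\<lbrakk>a \<in> A; x \<in> L a; u \<in> U\<rbrakk> \<Longrightarrow> partner u x \<in> L u" "\<lbrakk>a \<in> A; x \<in> L a; u \<in> U\<rbrakk> \<Longrightarrow> E x (partner u x)"
  using someI_ex[of "\<lambda>y. y \<in> L u \<and> E x y"] matched[of a x u] unfolding partner_def by blast+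

lemma partner_eq: "\<lbrakk>a \<in> A; x \<in> L a; u \<in> U; y \<in> L u; E x y\<rbrakk> \<Longrightarrow> y = partner u x"
  using cover(4)[of a u x y "partner u x"] partner[of a x u] disj by blast

lemma partner_inj: "\<lbrakk>a \<in> A; x \<in> L a; x' \<in> L a; u \<in> U; E x' (partner u x)\<rbrakk> \<Longrightarrow> x = x'"
  using cover(4)[of u a "partner u x" x x'] cover(3) partner[of a x u] disj by blast

text \<open>
  The lists on \<open>A\<close> embed into the list of \<open>u\<close>, which is therefore longer than \<open>|A|\<close>; a positive demand
  must then come from a neighbour in \<open>U\<close>.
\<close>
lemma ex_adjacent:
  assumes u: "u \<in> U"
  shows "\<exists>w\<in>U. adj u w"
proof -
  obtain a0 where a0: "a0 \<in> A" using A_nonempty by blast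
  have "card (L a0) \<le> card (L u)"
  proof (rule card_inj_on_le)
    show "inj_on (partner u) (L a0)"
      using partner_inj[OF a0 _ _ u] partner(2)[OF a0 _ u] by (metis inj_onI)
  qed (use partner(1)[OF a0 _ u] cover(2) u in auto)
  then have "card A + 1 \<le> card (L u)" using lists_A a0 colors_pos by fastforce
  then have "card {w \<in> U. adj u w} \<noteq> 0" using pos[OF u] unfolding demand_def by linarith
  then show ?thesis by (metis (mono_tags, lifting) card.empty empty_Collect_eq)
qed

definition lost :: "'v set \<Rightarrow> ('v \<Rightarrow> 'c) \<Rightarrow> 'v \<Rightarrow> 'c set" where
  "lost B f u = (\<lambda>b. partner u (f b)) ` B"

text \<open>
  The amount by which colouring \<open>B\<close> lowers the demand of \<open>u\<close>, unless zero is reached before: \<open>|B|\<close> for the vertices that leave \<open>A\<close>,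
  minus the colours that \<open>u\<close> loses.
\<close>
definition gain :: "'v set \<Rightarrow> ('v \<Rightarrow> 'c) \<Rightarrow> 'v \<Rightarrow> nat" where
  "gain B f u = card B - card (lost B f u)"

lemma killed_eq_lost:
  assumes "B \<subseteq> A" "transversal B L E f" "u \<in> U"
  shows "killed L E B f u = lost B f u"
proof -
  have "f b \<in> L b" "b \<in> A" if "b \<in> B" for b using that assms by (auto simp: transversal_def)
  then show ?thesis
    using partner[OF _ _ assms(3)] partner_eq[OF _ _ assms(3)] unfolding killed_def lost_def by blast
qed

lemma card_lost_le: "B \<subseteq> A \<Longrightarrow> card (lost B f u) \<le> card B"
  unfolding lost_def using finite_subset_A by (rule card_image_le)

lemma demand_residual_le_gain:
  assumes "B \<subseteq> A" "transversal B L E f" "u \<in> U"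
  shows "demand adj (A - B) U (residual L E B f) u \<le> demand adj A U L u - gain B f u"
  using demand_residual_le[OF cov assms(3,1), of f] card_lost_le[OF assms(1)] killed_eq_lost[OF assms] by (auto simp: gain_def)

text \<open>
  \<open>B\<close> uses up \<open>|B|\<close> units of the budget \<open>|A|\<close>, and the total demand falls by at least as much.
\<close>
lemma transversal_of_gain:
  assumes B: "B \<subseteq> A" "B \<noteq> {}" "transversal B L E f" and le: "\<And>u. u \<in> U \<Longrightarrow> gain B f u \<le> demand adj A U L u"
    and sum: "card B \<le> (\<Sum>u\<in>U. gain B f u)"
  shows "\<exists>h. transversal (A \<union> U) L E h"
proof (rule transversal_of_residual)
  have "(\<Sum>u\<in>U. demand adj (A - B) U (residual L E B f) u) \<le> (\<Sum>u\<in>U. demand adj A U L u - gain B f u)"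
    using demand_residual_le_gain[OF B(1,3)] by (intro sum_mono) auto
  also have "\<dots> = (\<Sum>u\<in>U. demand adj A U L u) - (\<Sum>u\<in>U. gain B f u)"
    using le by (intro sum_subtractf_nat) auto
  also have "\<dots> \<le> card A - card B" using demands sum by linarith
  also have "\<dots> = card (A - B)" using B(1) finite_subset_A by (simp add: card_Diff_subset)
  finally show "(\<Sum>u\<in>U. demand adj (A - B) U (residual L E B f) u) \<le> card (A - B)" .
  show "\<forall>a\<in>A - B. card (A - B) + k \<le> card (residual L E B f a)"
  proof
    fix a assume "a \<in> A - B"
    then have "card (L a) \<le> card (residual L E B f a) + card B" "card A + k \<le> card (L a)"
      using card_residual_ge[OF B(1) _ B(3)] lists_A by auto
    moreover have "card (A - B) = card A - card B" using B(1) finite_subset_A by (simp add: card_Diff_subset)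
    moreover have "card B \<le> card A" using B(1) fin by (simp add: card_mono)
    ultimately show "card (A - B) + k \<le> card (residual L E B f a)" by linarith
  qed
qed (use B disj colors in auto)

text \<open>
  A coloured set that falls short of paying for itself by at most one unit. Keeping every gain strictly
  below the demand ensures that no gain is wasted on a demand that is already met. A single vertex
  is always a run, with gain zero.
\<close>
definition run :: "'v set \<Rightarrow> ('v \<Rightarrow> 'c) \<Rightarrow> bool" where
  "run B f \<longleftrightarrow> B \<subseteq> A \<and> B \<noteq> {} \<and> transversal B L E f \<and>
    (\<forall>u\<in>U. gain B f u < demand adj A U L u) \<and> card B \<le> (\<Sum>u\<in>U. gain B f u) + 1"

lemma ex_maximal_run: "\<exists>B f. run B f \<and> (\<forall>B' f'. run B' f' \<longrightarrow> card B' \<le> card B)"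
proof -
  obtain a0 where a0: "a0 \<in> A" using A_nonempty by blast
  obtain x where "x \<in> L a0" using lists_A a0 colors_pos by fastforce
  then have "run {a0} (\<lambda>_. x)"
    using a0 pos unfolding run_def gain_def lost_def transversal_def by (auto simp: Suc_le_eq)
  moreover have "card B < Suc (card A)" if "run B f" for B f
    using that fin unfolding run_def by (simp add: card_mono less_Suc_eq_le)
  ultimately have "\<exists>q. run (fst q) (snd q) \<and> (\<forall>r. run (fst r) (snd r) \<longrightarrow> card (fst r) \<le> card (fst q))"
    by (intro ex_has_greatest_nat[where k = "({a0}, \<lambda>_. x)" and b = "Suc (card A)"]) simp_all
  then show ?thesis by (metis fst_conv snd_conv)
qed

end

locale maximal_run = matched_demand_instance adj E col A U L k
  for adj :: "'v \<Rightarrow> 'v \<Rightarrow> bool" and E :: "'c \<Rightarrow> 'c \<Rightarrow> bool" and col A U L k +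
  fixes B :: "'v set" and f :: "'v \<Rightarrow> 'c"
  assumes run: "run B f" and maximal: "\<And>B' f'. run B' f' \<Longrightarrow> card B' \<le> card B"
begin

lemma B: "B \<subseteq> A" "B \<noteq> {}" "transversal B L E f"
  and unsat: "\<And>u. u \<in> U \<Longrightarrow> gain B f u < demand adj A U L u"
  and B_le: "card B \<le> (\<Sum>u\<in>U. gain B f u) + 1"
  using run unfolding run_def by auto

lemma run_color: "b \<in> B \<Longrightarrow> f b \<in> L b" "b \<in> B \<Longrightarrow> b \<in> A"
  using B by (auto simp: transversal_def)

text \<open>
  The vertex \<open>b\<close> adds one to the gain at each vertex of the set \<open>I\<close> below, which contains \<open>v\<close>. If
  \<open>I\<close> has two elements, the enlarged set pays for itself. If \<open>I = {v}\<close>, it is at most one unit short,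
  as before, but by maximality it is not a run, so the demand of \<open>v\<close> is now met. Postponing \<open>v\<close>
  lowers the degree of a neighbour in \<open>U\<close>, whose demand supplies the missing unit.
\<close>
lemma transversal_of_extension:
  assumes b: "b \<in> A" "b \<notin> B" and x: "x \<in> L b" "\<And>c. c \<in> B \<Longrightarrow> \<not> E (f c) x"
    and v: "v \<in> U" "partner v x \<in> lost B f v"
  shows "\<exists>h. transversal (A \<union> U) L E h"
proof -
  define B' where "B' = insert b B"
  define f' where "f' = f(b := x)"
  have B': "B' \<subseteq> A" "B' \<noteq> {}" "transversal B' L E f'" "card B' = card B + 1"
  proof -
    have "\<not> E x (f c)" if "c \<in> B" for c using x(2)[OF that] cover(3) by blast
    then show "transversal B' L E f'"
      using B(3) b(2) x unfolding B'_def f'_def transversal_def by auto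
  qed (use B b finite_subset_A in \<open>auto simp: B'_def\<close>)
  define I where "I = {u \<in> U. partner u x \<in> lost B f u}"
  have g': "gain B' f' u = gain B f u + (if u \<in> I then 1 else 0)" if "u \<in> U" for u
  proof -
    have "lost B' f' u = insert (partner u x) (lost B f u)"
      using b(2) unfolding lost_def B'_def f'_def by auto
    moreover have "finite (lost B f u)" unfolding lost_def using finite_subset_A[OF B(1)] by simp
    ultimately have "card (lost B' f' u) = card (lost B f u) + (if u \<in> I then 0 else 1)"
      using that by (auto simp: I_def insert_absorb)
    then show ?thesis using card_lost_le[OF B(1), of f u] B'(4) by (auto simp: gain_def)
  qed
  have g'_le: "gain B' f' u \<le> demand adj A U L u" if "u \<in> U" for u
    using g'[OF that] unsat[OF that] by auto
  have "(\<Sum>u\<in>U. gain B' f' u) = (\<Sum>u\<in>U. gain B f u + (if u \<in> I then 1 else 0))"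
    using g' by (intro sum.cong) auto
  also have "\<dots> = (\<Sum>u\<in>U. gain B f u) + card I"
    using fin unfolding sum.distrib by (simp add: I_def sum.If_cases Int_def)
  finally have sum': "(\<Sum>u\<in>U. gain B' f' u) = (\<Sum>u\<in>U. gain B f u) + card I" .
  have vI: "v \<in> I" using v by (simp add: I_def)
  have fin_I: "finite I" using fin by (simp add: I_def)
  show ?thesis
  proof (cases "2 \<le> card I")
    case True
    then show ?thesis using transversal_of_gain[OF B'(1-3) g'_le] sum' B_le B'(4) by auto
  next
    case False
    then have "\<forall>u\<in>I. \<forall>w\<in>I. u = w" using card_le_Suc0_iff_eq[OF fin_I] by simp
    then have "I = {v}" using vI by blast
    have sum'': "(\<Sum>u\<in>U. gain B' f' u) = (\<Sum>u\<in>U. gain B f u) + 1" using sum' \<open>I = {v}\<close> by simp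
    have "\<not> run B' f'" using maximal[of B' f'] B'(4) by auto
    then obtain w where "w \<in> U" "\<not> gain B' f' w < demand adj A U L w"
      using B' sum'' B_le unfolding run_def by auto
    then have sat: "gain B' f' v = demand adj A U L v"
      using g'[of w] unsat[of w] g'_le[of w] \<open>I = {v}\<close> by (cases "w = v") auto
    let ?L = "residual L E B' f'"
    have cov': "cover_on adj ((A - B') \<union> U) ?L E" by (rule cover_on_residual[OF cov]) auto
    have "\<exists>h. transversal ((A - B') \<union> (U - {v})) ?L E h"
    proof (rule smaller)
      show "cover_on adj ((A - B') \<union> (U - {v})) ?L E" by (rule cover_on_residual[OF cov]) auto
      show "(A - B') \<union> (U - {v}) \<noteq> A \<union> U" using v(1) disj by auto
      show "card (col ` (U - {v})) \<le> k"
        using colors card_mono[of "col ` U" "col ` (U - {v})"] fin by (meson Diff_subset finite_imageI image_mono le_trans)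
      have cardAB: "card (A - B') = card A - card B'" "card B' \<le> card A"
        using B'(1) finite_subset_A fin by (simp_all add: card_Diff_subset card_mono)
      show "\<forall>a\<in>A - B'. card (A - B') + k \<le> card (?L a)"
      proof
        fix a assume "a \<in> A - B'"
        then have "card (L a) \<le> card (?L a) + card B'" "card A + k \<le> card (L a)"
          using card_residual_ge[OF B'(1) _ B'(3)] lists_A by auto
        then show "card (A - B') + k \<le> card (?L a)" using cardAB by linarith
      qed
      \<comment> \<open>The saving unit: \<open>u0\<close> loses its neighbour \<open>v\<close>, and its demand is still positive.\<close>
      obtain u0 where u0: "u0 \<in> U" "adj v u0" using ex_adjacent[OF v(1)] by blast
      have "u0 \<noteq> v" using u0 irrefl v(1) by auto
      have le: "demand adj (A - B') (U - {v}) ?L u \<le> demand adj A U L u - gain B' f' u" if "u \<in> U" for u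
      proof -
        have "demand adj (A - B') (U - {v}) ?L u \<le> demand adj (A - B') U ?L u"
          unfolding demand_def using fin by (intro diff_le_mono add_le_mono card_mono) auto
        then show ?thesis using demand_residual_le_gain[OF B'(1,3) that] by linarith
      qed
      have less: "demand adj (A - B') (U - {v}) ?L u0 < demand adj A U L u0 - gain B' f' u0"
      proof -
        have "card {w \<in> U - {v}. adj u0 w} < card {w \<in> U. adj u0 w}"
          using fin v(1) u0(2) sym by (intro psubset_card_mono) (auto dest: sympD)
        then have "demand adj (A - B') (U - {v}) ?L u0 < demand adj (A - B') U ?L u0 \<or>
            demand adj (A - B') (U - {v}) ?L u0 = 0"
          unfolding demand_def by linarith
        moreover have "gain B' f' u0 < demand adj A U L u0"
          using g'[OF u0(1)] unsat[OF u0(1)] \<open>I = {v}\<close> \<open>u0 \<noteq> v\<close> by simp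
        ultimately show ?thesis using demand_residual_le_gain[OF B'(1,3) u0(1)] by linarith
      qed
      have "(\<Sum>u\<in>U - {v}. demand adj (A - B') (U - {v}) ?L u) < (\<Sum>u\<in>U - {v}. demand adj A U L u - gain B' f' u)"
        using fin le less u0(1) \<open>u0 \<noteq> v\<close> by (intro sum_strict_mono_ex1) (auto intro!: bexI[of _ u0])
      also have "\<dots> \<le> (\<Sum>u\<in>U. demand adj A U L u - gain B' f' u)"
        using fin by (intro sum_mono2) auto
      also have "\<dots> = (\<Sum>u\<in>U. demand adj A U L u) - (\<Sum>u\<in>U. gain B' f' u)"
        using g'_le by (intro sum_subtractf_nat) auto
      finally show "(\<Sum>u\<in>U - {v}. demand adj (A - B') (U - {v}) ?L u) \<le> card (A - B')"
        using demands sum'' B_le B'(4) cardAB by linarith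
    qed auto
    then obtain h where h: "transversal ((A - B') \<union> (U - {v})) ?L E h" by blast
    have "demand adj (A - B') U ?L v = 0" using demand_residual_le_gain[OF B'(1,3) v(1)] sat by simp
    then obtain h where h: "transversal ((A - B') \<union> U) ?L E h"
      using transversal_extend_saturated[OF cov' _ sym v(1) irrefl[OF v(1)] _ h] disj by blast
    show ?thesis
      by (rule transversal_extend[OF cov _ _ B'(3) h]) (use B'(1) disj in auto)
  qed
qed

text \<open>
  Unless \<open>B\<close> pays for itself, the gains sum to \<open>|B| - 1\<close>. A vertex \<open>b\<close> of \<open>B\<close> collides at \<open>u\<close> if
  another vertex of \<open>B\<close> kills the same colour there. There are at most twice as many collisions as
  gains, hence fewer than \<open>2 |B|\<close>, and some \<open>b0\<close> collides at no more than one vertex of \<open>U\<close>. Some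
  colour class \<open>W\<close> of \<open>U\<close> avoids that vertex. Now \<open>b0\<close> is left uncoloured, and each \<open>w\<close> in \<open>W\<close> receives
  the colour that \<open>f b0\<close> would have killed.
  
  At \<open>u\<close> outside \<open>W\<close> the vertices of \<open>W\<close> that are its neighbours kill at most as many colours as
  they contribute to the degree, so \<open>u\<close> gains from \<open>B - {b0}\<close> as much as it gained from \<open>B\<close>, up to
  one unit where \<open>b0\<close> collides. That loss is made up for by the positive demands left on \<open>W\<close>, which
  disappear with \<open>W\<close>.
  
  At \<open>a\<close> in \<open>A\<close>, a colour killed by \<open>W\<close> has a partner in common with \<open>f b0\<close>. Since \<open>B\<close> is stuck it was
  killed by \<open>B\<close> already, or it is \<open>f b0\<close> itself in case \<open>a = b0\<close>. So at most \<open>|B|\<close> colours are killed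
  although only \<open>|B| - 1\<close> vertices leave \<open>A\<close>; the excess is covered by the colour class that
  is gone.
\<close>
lemma transversal_of_stuck:
  assumes stuck: "\<And>a x u. \<lbrakk>a \<in> A - B; x \<in> L a; u \<in> U; partner u x \<in> lost B f u\<rbrakk> \<Longrightarrow> \<exists>c\<in>B. E (f c) x"
  shows "\<exists>h. transversal (A \<union> U) L E h"
proof (cases "card B \<le> (\<Sum>u\<in>U. gain B f u)")
  case True
  then show ?thesis using transversal_of_gain[OF B] unsat by (meson less_imp_le)
next
  case False
  define coll where "coll u = {b \<in> B. \<exists>b'\<in>B. b' \<noteq> b \<and> partner u (f b) = partner u (f b')}" for u
  have coll_le: "card (coll u) \<le> 2 * gain B f u" for u
    using card_colliding_le[OF finite_subset_A[OF B(1)], of "\<lambda>b. partner u (f b)"] unfolding coll_def gain_def lost_def by linarith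
  \<comment> \<open>Double counting of the pairs \<open>(b, u)\<close> with \<open>b \<in> coll u\<close>.\<close>
  have "\<exists>b0\<in>B. card {u \<in> U. b0 \<in> coll u} \<le> 1"
  proof (rule ccontr)
    assume "\<not> ?thesis"
    then have "2 \<le> card {u \<in> U. b \<in> coll u}" if "b \<in> B" for b using that by fastforce
    then have "2 * card B \<le> (\<Sum>b\<in>B. card {u \<in> U. b \<in> coll u})"
      using sum_mono[of B "\<lambda>_. 2" "\<lambda>b. card {u \<in> U. b \<in> coll u}"] by simp
    also have "\<dots> = (\<Sum>u\<in>U. card (coll u))"
    proof (rule sum_multicount_gen)
      show "\<forall>u\<in>U. card {b \<in> B. b \<in> coll u} = card (coll u)"
        by (intro ballI arg_cong[of _ _ card]) (auto simp: coll_def)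
    qed (use fin finite_subset_A B(1) in auto)
    also have "\<dots> \<le> (\<Sum>u\<in>U. 2 * gain B f u)" using coll_le by (intro sum_mono)
    also have "\<dots> = 2 * (\<Sum>u\<in>U. gain B f u)" by (simp add: sum_distrib_left)
    finally show False using False by linarith
  qed
  then obtain b0 where b0: "b0 \<in> B" "card {u \<in> U. b0 \<in> coll u} \<le> 1" by blast
  obtain i where i: "i \<in> col ` U" "\<And>u. u \<in> U \<Longrightarrow> col u = i \<Longrightarrow> b0 \<notin> coll u"
  proof (cases "{u \<in> U. b0 \<in> coll u} = {}")
    case True
    then show ?thesis using U that by blast
  next
    case False
    then obtain u0 where u0: "u0 \<in> U" "b0 \<in> coll u0" by blast
    have u0_only: "u = u0" if "u \<in> U" "b0 \<in> coll u" for u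
      using card_le_Suc0_iff_eq[of "{u \<in> U. b0 \<in> coll u}"] b0(2) fin that u0 by auto
    \<comment> \<open>The class of a neighbour of \<open>u0\<close> does not contain \<open>u0\<close>.\<close>
    obtain w where w: "w \<in> U" "adj u0 w" using ex_adjacent[OF u0(1)] by blast
    have "b0 \<notin> coll u" if "u \<in> U" "col u = col w" for u
      using u0_only[OF that(1)] proper u0(1) w that by metis
    then show ?thesis using that[of "col w"] w(1) by blast
  qed
  define W where "W = {u \<in> U. col u = i}"
  define C where "C = (B - {b0}) \<union> W"
  define A' where "A' = A - (B - {b0})"
  define U' where "U' = U - W"
  define \<psi> where "\<psi> v = (if v \<in> W then partner v (f b0) else f v)" for v
  have W: "W \<subseteq> U" "W \<noteq> {}" "finite W" using i(1) fin by (auto simp: W_def)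
  have b0A: "b0 \<in> A" "f b0 \<in> L b0" using run_color b0 by auto
  have \<psi>B: "\<psi> b = f b" if "b \<in> B" for b using that B(1) W(1) disj by (auto simp: \<psi>_def)
  have \<psi>W: "\<psi> w = partner w (f b0)" if "w \<in> W" for w using that by (simp add: \<psi>_def)
  have sepBW: "\<not> E (f b) (partner w (f b0))" if "b \<in> B" "b \<noteq> b0" "w \<in> W" for b w
  proof
    assume "E (f b) (partner w (f b0))"
    then have "partner w (f b0) = partner w (f b)"
      using partner_eq[of b "f b" w] partner(1)[OF b0A(1,2)] run_color that W(1) by blast
    then have "b0 \<in> coll w" using that b0 unfolding coll_def by blast
    then show False using i(2) that(3) by (auto simp: W_def)
  qed
  have trC: "transversal C L E \<psi>"
  proof -
    have "\<psi> v \<in> L v" if "v \<in> C" for v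
      using that run_color \<psi>B \<psi>W partner(1)[OF b0A] W(1) by (auto simp: C_def)
    moreover have "\<not> E (\<psi> p) (\<psi> q)" if pq: "p \<in> C" "q \<in> C" "p \<noteq> q" for p q
    proof -
      consider "p \<in> B - {b0}" "q \<in> B - {b0}" | "p \<in> B - {b0}" "q \<in> W" | "p \<in> W" "q \<in> B - {b0}" | "p \<in> W" "q \<in> W"
        using pq by (auto simp: C_def)
      then show ?thesis
      proof cases
        case 1
        then show ?thesis using B(3) pq(3) \<psi>B by (auto simp: transversal_def)
      next
        case 2
        then show ?thesis using sepBW \<psi>B \<psi>W by auto
      next
        case 3
        then show ?thesis using sepBW[of q p] cover(3)[of "\<psi> p" "\<psi> q"] \<psi>B \<psi>W by auto
      next
        case 4
        then have "p \<in> U" "q \<in> U" "col p = col q" by (auto simp: W_def)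
        then have "\<not> adj p q" using proper by metis
        then show ?thesis
          using cover(5)[of p q "\<psi> p" "\<psi> q"] 4 pq(3) W(1) \<psi>W partner(1)[OF b0A] by auto
      qed
    qed
    ultimately show ?thesis by (simp add: transversal_def)
  qed
  have A'C: "A' = A - C" and U'C: "U' = U - C"
    using W(1) B(1) disj by (auto simp: A'_def U'_def C_def)
  have cardA': "card A' + card B = card A + 1"
  proof -
    have "card A' = card A - card (B - {b0})"
      unfolding A'_def using B(1) finite_subset_A by (intro card_Diff_subset) auto
    moreover have "card (B - {b0}) + 1 = card B" using card_Suc_Diff1[OF finite_subset_A[OF B(1)] b0(1)] by linarith
    moreover have "card B \<le> card A" using B(1) fin by (simp add: card_mono)
    ultimately show ?thesis by linarith
  qed
  have lists_A': "card A' + (k - 1) \<le> card (residual L E C \<psi> a)" if a: "a \<in> A'" for a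
  proof -
    have aA: "a \<in> A" "a \<notin> B - {b0}" using a by (auto simp: A'_def)
    have sub: "killed L E C \<psi> a \<subseteq> killed L E (B - {b0}) f a \<union> killed L E W \<psi> a"
      using \<psi>B unfolding killed_def C_def by auto
    have small: "card (killed L E S f a) \<le> card S" if "S \<subseteq> B" "a \<notin> S" for S
    proof -
      have "card (killed L E S f a) \<le> card {x \<in> S. adj x a}"
        by (rule card_killed_le[OF cov]) (use that B(1) aA run_color in auto)
      also have "\<dots> \<le> card S" using that(1) B(1) finite_subset_A[of S] by (intro card_mono) auto
      finally show ?thesis .
    qed
    have "card (killed L E C \<psi> a) \<le> card B"
    proof (cases "a = b0")
      case True
      have "killed L E W \<psi> b0 \<subseteq> {f b0}"
      proof
        fix x assume "x \<in> killed L E W \<psi> b0"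
        then obtain w where w: "x \<in> L b0" "w \<in> W" "E (partner w (f b0)) x" using \<psi>W by (auto simp: killed_def)
        then have "f b0 = x" using partner_inj[OF b0A w(1) _ cover(3)] W(1) by blast
        then show "x \<in> {f b0}" by simp
      qed
      then have "killed L E C \<psi> a \<subseteq> insert (f b0) (killed L E (B - {b0}) f a)" using sub True by auto
      moreover have "finite (killed L E (B - {b0}) f a)" using cover(2) aA(1) by (auto simp: killed_def)
      ultimately have "card (killed L E C \<psi> a) \<le> card (insert (f b0) (killed L E (B - {b0}) f a))"
        by (intro card_mono) auto
      also have "\<dots> \<le> card (killed L E (B - {b0}) f a) + 1"
        by (simp add: card_insert_le_m1 card_insert_if \<open>finite (killed L E (B - {b0}) f a)\<close>)
      also have "\<dots> \<le> card (B - {b0}) + 1" using small[of "B - {b0}"] aA by auto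
      also have "\<dots> = card B" using card_Suc_Diff1[OF finite_subset_A[OF B(1)] b0(1)] by linarith
      finally show ?thesis .
    next
      case False
      then have aB: "a \<in> A - B" using aA by auto
      have "killed L E W \<psi> a \<subseteq> killed L E B f a"
      proof
        fix x assume "x \<in> killed L E W \<psi> a"
        then obtain w where w: "x \<in> L a" "w \<in> W" "E (partner w (f b0)) x" using \<psi>W by (auto simp: killed_def)
        then have wU: "w \<in> U" using W(1) by auto
        have "partner w (f b0) = partner w x"
          using partner_eq[OF aA(1) w(1) wU partner(1)[OF b0A wU] cover(3)[OF w(3)]] .
        then have "partner w x \<in> lost B f w" using b0(1) unfolding lost_def by (metis imageI)
        then show "x \<in> killed L E B f a" using stuck[OF aB w(1) wU] w(1) by (auto simp: killed_def)
      qed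
      then have "killed L E C \<psi> a \<subseteq> killed L E B f a"
        using sub killed_mono[of "B - {b0}" B L E f a] by blast
      then have "card (killed L E C \<psi> a) \<le> card (killed L E B f a)"
        using cover(2) aA(1) by (intro card_mono) (auto simp: killed_def)
      also have "\<dots> \<le> card B" using small[of B] aB by auto
      finally show ?thesis .
    qed
    moreover have "card (L a) = card (residual L E C \<psi> a) + card (killed L E C \<psi> a)"
      using cover(2) aA(1) by (intro card_residual) auto
    moreover have "card A + k \<le> card (L a)" using lists_A aA(1) by auto
    ultimately show ?thesis using cardA' colors_pos by linarith
  qed
  let ?D = "demand adj A' U' (residual L E C \<psi>)"
  have demand': "?D u + gain B f u \<le> demand adj A U L u + (if b0 \<in> coll u then 1 else 0)" if u: "u \<in> U'" for u
  proof -
    have uU: "u \<in> U" "u \<notin> W" using u by (auto simp: U'_def)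
    have fin_lost: "finite (lost S f u)" if "S \<subseteq> B" for S
      unfolding lost_def using that B(1) finite_subset_A[of S] by auto
    have "killed L E C \<psi> u \<subseteq> killed L E (B - {b0}) f u \<union> killed L E W \<psi> u"
      using \<psi>B unfolding killed_def C_def by auto
    then have "card (killed L E C \<psi> u) \<le> card (killed L E (B - {b0}) f u \<union> killed L E W \<psi> u)"
      using cover(2) uU by (intro card_mono) (auto simp: killed_def)
    also have "\<dots> \<le> card (killed L E (B - {b0}) f u) + card (killed L E W \<psi> u)" by (rule card_Un_le)
    also have "killed L E (B - {b0}) f u = lost (B - {b0}) f u"
      using B uU by (intro killed_eq_lost) (auto simp: transversal_def)
    finally have 1: "card (killed L E C \<psi> u) \<le> card (lost (B - {b0}) f u) + card (killed L E W \<psi> u)" .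
    have 2: "card (killed L E W \<psi> u) \<le> card {w \<in> W. adj w u}"
      by (rule card_killed_le[OF cov]) (use uU W(1) \<psi>W partner(1)[OF b0A] in auto)
    have "{w \<in> U. adj u w} = {w \<in> U'. adj u w} \<union> {w \<in> W. adj w u}"
      using W(1) sym unfolding U'_def by (auto dest: sympD)
    moreover have "{w \<in> U'. adj u w} \<inter> {w \<in> W. adj w u} = {}" by (auto simp: U'_def)
    ultimately have 3: "card {w \<in> U. adj u w} = card {w \<in> U'. adj u w} + card {w \<in> W. adj w u}"
      using fin W(3) by (simp add: card_Un_disjoint U'_def)
    have lost_B: "lost B f u = insert (partner u (f b0)) (lost (B - {b0}) f u)"
      using b0(1) unfolding lost_def by (metis image_insert insert_Diff)
    have "card (lost (B - {b0}) f u) + 1 \<le> card (lost B f u) + (if b0 \<in> coll u then 1 else 0)"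
    proof (cases "b0 \<in> coll u")
      case True
      have "card (lost (B - {b0}) f u) \<le> card (lost B f u)"
        using fin_lost[of B] by (intro card_mono) (auto simp: lost_def)
      then show ?thesis using True by simp
    next
      case False
      then have "partner u (f b0) \<notin> lost (B - {b0}) f u" using b0(1) unfolding coll_def lost_def by auto
      then show ?thesis using lost_B fin_lost[of "B - {b0}"] False by simp
    qed
    then have 4: "card (lost (B - {b0}) f u) + 1 + gain B f u \<le> card B + (if b0 \<in> coll u then 1 else 0)"
      using card_lost_le[OF B(1), of f u] unfolding gain_def by linarith
    have 5: "card (L u) = card (residual L E C \<psi> u) + card (killed L E C \<psi> u)"
      using cover(2) uU by (intro card_residual) auto
    have 6: "gain B f u < demand adj A U L u" using unsat uU by auto
    \<comment> \<open>Truncated subtraction is harmless on the right, as \<open>u\<close> has a demand above its gain.\<close>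
    have "d' + a' + 1 - R + g \<le> d + a + 1 - l + e"
      if "K \<le> i + K'" "K' \<le> w" "d = d' + w" "i + 1 + g \<le> b + e" "l = R + K" "g < d + a + 1 - l" "a' + b = a + 1"
      for d' a' R g d a l e K i K' w b :: nat
      using that by linarith
    from this[OF 1 2 3 4 5 6[unfolded demand_def] cardA'] show ?thesis unfolding demand_def .
  qed
  show ?thesis
  proof (rule transversal_of_residual[OF _ _ trC A'C U'C])
    show "C \<subseteq> A \<union> U" "C \<noteq> {}" using B(1) W by (auto simp: C_def)
    have "col ` U' \<subseteq> col ` U - {i}" by (auto simp: U'_def W_def)
    then have "card (col ` U') \<le> card (col ` U - {i})" using fin by (intro card_mono) auto
    also have "\<dots> = card (col ` U) - 1" using i(1) by simp
    finally show "card (col ` U') \<le> k - 1" using colors by linarith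
    show "\<forall>a\<in>A'. card A' + (k - 1) \<le> card (residual L E C \<psi> a)" using lists_A' by blast
    have "(\<Sum>u\<in>U'. ?D u) + (\<Sum>u\<in>U'. gain B f u) \<le>
        (\<Sum>u\<in>U'. demand adj A U L u) + (\<Sum>u\<in>U'. if b0 \<in> coll u then 1 else 0)"
      unfolding sum.distrib[symmetric] by (rule sum_mono) (use demand' in auto)
    also have "(\<Sum>u\<in>U'. if b0 \<in> coll u then 1 else 0 :: nat) = card {u \<in> U'. b0 \<in> coll u}"
      using fin by (simp add: sum.If_cases Int_def U'_def)
    also have "\<dots> \<le> card {u \<in> U. b0 \<in> coll u}" using fin by (intro card_mono) (auto simp: U'_def)
    also have "\<dots> \<le> 1" by (rule b0(2))
    finally have 1: "(\<Sum>u\<in>U'. ?D u) + (\<Sum>u\<in>U'. gain B f u) \<le> (\<Sum>u\<in>U'. demand adj A U L u) + 1" by simp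
    \<comment> \<open>This strict inequality pays for the one collision of \<open>b0\<close>.\<close>
    have "(\<Sum>u\<in>W. gain B f u) < (\<Sum>u\<in>W. demand adj A U L u)"
      using W unsat by (intro sum_strict_mono) auto
    moreover have split: "(\<Sum>u\<in>U. h u) = (\<Sum>u\<in>U'. h u) + (\<Sum>u\<in>W. h u)" for h :: "'v \<Rightarrow> nat"
      unfolding U'_def by (rule sum.subset_diff) (use W fin in auto)
    ultimately have "(\<Sum>u\<in>U'. ?D u) + (\<Sum>u\<in>U. gain B f u) \<le> (\<Sum>u\<in>U. demand adj A U L u)"
      using 1 split[of "gain B f"] split[of "demand adj A U L"] by linarith
    then show "(\<Sum>u\<in>U'. ?D u) \<le> card A'" using demands B_le cardA' by linarith
  qed
qed

end

text \<open>
  The induction behind the general bound. In each step a nonempty set of vertices is coloured or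
  postponed in such a way that all three hypotheses (colour classes, lists on \<open>A\<close>, total demand)
  survive with the new \<open>A\<close>, \<open>U\<close> and \<open>k\<close>.
\<close>
theorem transversal_of_demand_le:
  fixes adj :: "'v \<Rightarrow> 'v \<Rightarrow> bool" and E :: "'c \<Rightarrow> 'c \<Rightarrow> bool" and col :: "'v \<Rightarrow> nat"
  assumes "symp adj"
  shows "cover_on adj (A \<union> U) L E \<Longrightarrow> A \<inter> U = {} \<Longrightarrow> \<forall>u\<in>U. \<forall>w\<in>U. adj u w \<longrightarrow> col u \<noteq> col w \<Longrightarrow>
    card (col ` U) \<le> k \<Longrightarrow> \<forall>a\<in>A. card A + k \<le> card (L a) \<Longrightarrow>
    (\<Sum>u\<in>U. demand adj A U L u) \<le> card A \<Longrightarrow> \<exists>h. transversal (A \<union> U) L E h"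
proof (induction "card A + card U" arbitrary: A U L k rule: less_induct)
  case less
  have fin: "finite A" "finite U" using cover_onD(1)[OF less.prems(1)] by auto
  interpret demand_instance adj E col A U L k
  proof
    fix A' U' L' k'
    assume sub: "A' \<subseteq> A" "U' \<subseteq> U" "A' \<union> U' \<noteq> A \<union> U"
      and prems: "cover_on adj (A' \<union> U') L' E" "card (col ` U') \<le> k'" "\<forall>a\<in>A'. card A' + k' \<le> card (L' a)"
        "(\<Sum>u\<in>U'. demand adj A' U' L' u) \<le> card A'"
    show "\<exists>h. transversal (A' \<union> U') L' E h"
    proof (rule less.hyps)
      have "card (A' \<union> U') < card (A \<union> U)" using sub fin by (intro psubset_card_mono) auto
      then show "card A' + card U' < card A + card U"
        using sub less.prems(2) fin card_Un_disjoint[of A U] card_Un_disjoint[of A' U']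
        by (metis (no_types, lifting) disjoint_iff finite_subset subset_iff)
      show "A' \<inter> U' = {}" using sub less.prems(2) by blast
      show "\<forall>u\<in>U'. \<forall>w\<in>U'. adj u w \<longrightarrow> col u \<noteq> col w" using sub(2) less.prems(3) by blast
    qed (use prems in auto)
  qed (use assms less.prems in auto)
  consider "U = {}" | u where "u \<in> U" "demand adj A U L u = 0"
    | a x u where "a \<in> A" "x \<in> L a" "u \<in> U" "\<forall>y\<in>L u. \<not> E x y" "1 \<le> demand adj A U L u"
    | "matched_demand_instance adj E col A U L k"
  proof (cases "U = {} \<or> (\<exists>u\<in>U. demand adj A U L u = 0) \<or> (\<exists>a\<in>A. \<exists>x\<in>L a. \<exists>u\<in>U. \<forall>y\<in>L u. \<not> E x y)")
    case True
    then show ?thesis using that(1-3) by (metis less_one not_le)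
  next
    case False
    then have "matched_demand_instance adj E col A U L k"
      by unfold_locales (auto simp: Suc_le_eq)
    then show ?thesis by (rule that(4))
  qed
  then show ?case
  proof cases
    case 1
    then show ?thesis using transversal_greedy[OF cov] lists_A by fastforce
  next
    case 2
    then show ?thesis by (rule transversal_of_saturated)
  next
    case 3
    then show ?thesis by (rule transversal_of_unmatched)
  next
    case 4
    then interpret matched_demand_instance adj E col A U L k .
    obtain B f where "run B f" "\<And>B' f'. run B' f' \<Longrightarrow> card B' \<le> card B" using ex_maximal_run by blast
    then interpret maximal_run adj E col A U L k B f by unfold_locales
    show ?thesis
    proof (cases "\<exists>b\<in>A - B. \<exists>x\<in>residual L E B f b. \<exists>v\<in>U. partner v x \<in> lost B f v")
      case True
      then show ?thesis using transversal_of_extension by (auto simp: residual_def)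
    next
      case False
      then show ?thesis by (intro transversal_of_stuck) (auto simp: residual_def)
    qed
  qed
qed

section \<open>Covers of nearly complete graphs\<close>

lemma ex_avoiding_two:
  assumes "cover_on adj V L E" "p \<in> V" "q \<in> V" "v \<in> V" "p \<noteq> v" "q \<noteq> v" "x \<in> L p" "y \<in> L q" "3 \<le> card (L v)"
  shows "\<exists>z\<in>L v. \<not> E x z \<and> \<not> E y z"
proof -
  note c = cover_onD[OF assms(1)]
  have small: "card {z \<in> L v. E x' z} \<le> 1" if "p' \<in> V" "p' \<noteq> v" "x' \<in> L p'" for p' x'
  proof -
    have "\<forall>z\<in>{z \<in> L v. E x' z}. \<forall>z'\<in>{z \<in> L v. E x' z}. z = z'"
      using c(4)[OF that(1) assms(4) that(2,3)] by blast
    then show ?thesis using card_le_Suc0_iff_eq[of "{z \<in> L v. E x' z}"] c(2)[OF assms(4)] by simp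
  qed
  have "card ({z \<in> L v. E x z} \<union> {z \<in> L v. E y z}) \<le> card {z \<in> L v. E x z} + card {z \<in> L v. E y z}"
    by (rule card_Un_le)
  also have "\<dots> < card (L v)"
    using small[OF assms(2,5,7)] small[OF assms(3,6,8)] assms(9) by linarith
  finally have "{z \<in> L v. E x z} \<union> {z \<in> L v. E y z} \<noteq> L v" by auto
  then show ?thesis by blast
qed

lemma wheel_transversalI:
  assumes "cover_on adj {a, p, q, r, s} L E" "distinct [a, p, q, r, s]" "\<not> adj p r" "\<not> adj q s"
    and mem: "xa \<in> L a" "xp \<in> L p" "xq \<in> L q" "xr \<in> L r" "xs \<in> L s"
    and spokes: "\<not> E xa xp" "\<not> E xa xq" "\<not> E xa xr" "\<not> E xa xs"
    and rim: "\<not> E xp xq" "\<not> E xq xr" "\<not> E xr xs" "\<not> E xs xp"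
  shows "\<exists>h. transversal {a, p, q, r, s} L E h"
proof -
  note c = cover_onD[OF assms(1)]
  have diag: "\<not> E xp xr" "\<not> E xq xs" using c(5)[of p r xp xr] c(5)[of q s xq xs] assms(2-4) mem by auto
  have E_sym: "\<not> E y x" if "\<not> E x y" for x y using that c(3) by blast
  note no = spokes rim diag
  have "transversal {a, p, q, r, s} L E (\<lambda>v. if v = a then xa else if v = p then xp else if v = q then xq else if v = r then xr else xs)"
    using assms(2) mem no no[THEN E_sym] unfolding transversal_def by auto
  then show ?thesis by blast
qed

text \<open>
  With the hub coloured \<open>x\<close>, the list of \<open>p\<close> would keep three colours. Colouring the rim in the order
  \<open>q, r, s, p\<close> then succeeds, since \<open>p\<close> has only two neighbours on the rim.
\<close>
lemma wheel_spoke_matched: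
  assumes "cover_on adj {a, p, q, r, s} L E" "distinct [a, p, q, r, s]" "\<not> adj p r" "\<not> adj q s"
    and big: "3 \<le> card (L a)" "3 \<le> card (L p)" "3 \<le> card (L q)" "3 \<le> card (L r)" "3 \<le> card (L s)"
    and none: "\<nexists>h. transversal {a, p, q, r, s} L E h" and x: "x \<in> L a"
  shows "\<exists>y\<in>L p. E x y"
proof (rule ccontr)
  assume no: "\<not> ?thesis"
  note pick = ex_avoiding_two[OF assms(1)] and E_sym = cover_onD(3)[OF assms(1)]
  have d: "a \<noteq> p" "a \<noteq> q" "a \<noteq> r" "a \<noteq> s" "p \<noteq> q" "q \<noteq> r" "r \<noteq> s" "s \<noteq> p" using assms(2) by auto
  obtain xq where xq: "xq \<in> L q" "\<not> E x xq" using pick[of a a q x x] d x big by auto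
  obtain xr where xr: "xr \<in> L r" "\<not> E x xr" "\<not> E xq xr" using pick[of a q r x xq] d x xq big by auto
  obtain xs where xs: "xs \<in> L s" "\<not> E x xs" "\<not> E xr xs" using pick[of a r s x xr] d x xr big by auto
  obtain xp where xp: "xp \<in> L p" "\<not> E xq xp" "\<not> E xs xp" using pick[of q s p xq xs] d xq xs big by auto
  have "\<not> E x xp" using no xp(1) by blast
  moreover have "\<not> E xp xq" using xp(2) E_sym by blast
  ultimately show False
    using wheel_transversalI[OF assms(1-4) x xp(1) xq(1) xr(1) xs(1)] xq xr xs xp none by blast
qed

text \<open>
  Suppose \<open>y\<close> and \<open>z\<close> do not conflict. The neighbour of \<open>y\<close> in the list of \<open>q\<close>, if there is one,
  corresponds to a hub colour \<open>w\<close> different from \<open>x\<close>; otherwise let \<open>w\<close> be any other hub colour. Giving the hub the colour \<open>w\<close> and \<open>p\<close> the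
  colour \<open>y\<close> leaves no conflict between \<open>p\<close> and the residual list of \<open>q\<close>, so the rest of the rim can be
  coloured in the order \<open>s, r, q\<close>.
\<close>
lemma wheel_rim_matched:
  assumes "cover_on adj {a, p, q, r, s} L E" "distinct [a, p, q, r, s]" "\<not> adj p r" "\<not> adj q s"
    and card: "card (L a) = 3" "card (L p) = 3" "card (L q) = 3" "card (L r) = 3" "card (L s) = 3"
    and none: "\<nexists>h. transversal {a, p, q, r, s} L E h"
    and spokes: "\<And>x. x \<in> L a \<Longrightarrow> \<exists>y\<in>L q. E x y"
    and x: "x \<in> L a" "y \<in> L p" "z \<in> L q" "E x y" "E x z"
  shows "E y z"
proof (rule ccontr)
  assume no: "\<not> E y z"
  note c = cover_onD[OF assms(1)]
  note pick = ex_avoiding_two[OF assms(1)]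
  have d: "a \<noteq> p" "a \<noteq> q" "a \<noteq> r" "a \<noteq> s" "p \<noteq> q" "q \<noteq> r" "r \<noteq> s" "s \<noteq> p" using assms(2) by auto
  obtain N where N: "\<And>w. w \<in> L a \<Longrightarrow> N w \<in> L q" "\<And>w. w \<in> L a \<Longrightarrow> E w (N w)" using spokes by metis
  have "inj_on N (L a)"
    using c(4)[of q a "N _"] c(3) N d by (intro inj_onI) (metis insertCI)
  then have "card (N ` L a) = card (L q)" using card by (simp add: card_image)
  moreover have "N ` L a \<subseteq> L q" using N by blast
  ultimately have surj: "N ` L a = L q" using c(2)[of q] by (metis card_subset_eq insertCI)
  have "\<exists>w\<in>L a. w \<noteq> x \<and> (\<forall>z'\<in>L q. E y z' \<longrightarrow> E w z')"
  proof (cases "\<exists>z'\<in>L q. E y z'")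
    case True
    then obtain z' where z': "z' \<in> L q" "E y z'" by blast
    then obtain w where w: "w \<in> L a" "z' = N w" using surj by blast
    have "w \<noteq> x"
    proof
      assume "w = x"
      then have "z' = z" using c(4)[of a q x z' z] N(2)[OF w(1)] w z' x d by auto
      then show False using z' no by simp
    qed
    moreover have "z'' = z'" if "z'' \<in> L q" "E y z''" for z'' using c(4)[of p q y z'' z'] that z' x d by auto
    ultimately show ?thesis using w N(2)[OF w(1)] by blast
  next
    case False
    have "L a \<noteq> {x}" using card(1) by auto
    then show ?thesis using x(1) False by blast
  qed
  then obtain w where w: "w \<in> L a" "w \<noteq> x" "\<And>z'. z' \<in> L q \<Longrightarrow> E y z' \<Longrightarrow> E w z'" by blast
  have wy: "\<not> E w y" using c(4)[of p a y x w] c(3) w x d by blast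
  obtain xs where xs: "xs \<in> L s" "\<not> E w xs" "\<not> E y xs" using pick[of a p s w y] d x w card by auto
  obtain xr where xr: "xr \<in> L r" "\<not> E w xr" "\<not> E xs xr" using pick[of a s r w xs] d xs w card by auto
  obtain xq where xq: "xq \<in> L q" "\<not> E w xq" "\<not> E xr xq" using pick[of a r q w xr] d xr w card by auto
  have "\<not> E y xq" using w(3)[OF xq(1)] xq(2) by blast
  moreover have "\<not> E xq xr" "\<not> E xr xs" "\<not> E xs y" using xq(3) xr(3) xs(3) c(3) by blast+
  ultimately show False
    using wheel_transversalI[OF assms(1-4) w(1) x(2) xq(1) xr(1) xs(1)] wy xq xr xs none by blast
qed

text \<open>
  Without a transversal, every hub colour \<open>x\<close> names a colour \<open>N v x\<close> at each rim vertex \<open>v\<close>, and by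
  \<open>wheel_rim_matched\<close> two neighbours on the rim conflict only in colours of the same name. Giving the
  hub the name \<open>x1\<close> and the rim alternately \<open>x2\<close> and \<open>x3\<close> is then a transversal after all.
\<close>
lemma transversal_wheel_of_card_eq:
  assumes cov: "cover_on adj {a, p, q, r, s} L E" and d: "distinct [a, p, q, r, s]"
    and nadj: "\<not> adj p r" "\<not> adj r p" "\<not> adj q s" "\<not> adj s q"
    and card: "\<And>v. v \<in> {a, p, q, r, s} \<Longrightarrow> card (L v) = 3"
  shows "\<exists>h. transversal {a, p, q, r, s} L E h"
proof (rule ccontr)
  assume none: "\<not> ?thesis"
  note c = cover_onD[OF cov]
  \<comment> \<open>The hypotheses are invariant under rotating the rim, which transfers the two preceding lemmas from
    \<open>p\<close> and \<open>q\<close> to all rim vertices and edges.\<close>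
  let ?rotation = "\<lambda>p' q' r' s'. {a, p', q', r', s'} = {a, p, q, r, s} \<and> distinct [a, p', q', r', s'] \<and>
    \<not> adj p' r' \<and> \<not> adj q' s'"
  have rot: "?rotation p q r s" "?rotation q r s p" "?rotation r s p q" "?rotation s p q r"
    using d nadj by auto
  have card': "card (L a) = 3 \<and> card (L p') = 3 \<and> card (L q') = 3 \<and> card (L r') = 3 \<and> card (L s') = 3"
    if R: "?rotation p' q' r' s'" for p' q' r' s'
  proof -
    have "\<forall>v\<in>{a, p', q', r', s'}. card (L v) = 3" using R card by simp
    then show ?thesis by simp
  qed
  have spoke_rot: "\<exists>y\<in>L p'. E x y" if "?rotation p' q' r' s'" "x \<in> L a" for p' q' r' s' x
    by (rule wheel_spoke_matched[of adj a p' q' r' s']) (use that cov none card'[OF that(1)] in auto)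
  have spoke: "\<exists>y\<in>L v. E x y" if "v \<in> {p, q, r, s}" "x \<in> L a" for v x
    using rot[THEN spoke_rot, OF that(2)] that(1) by auto
  then obtain N where N: "\<And>v x. v \<in> {p, q, r, s} \<Longrightarrow> x \<in> L a \<Longrightarrow> N v x \<in> L v \<and> E x (N v x)" by metis
  have rim_rot: "E (N p' x) (N q' x)" if R: "?rotation p' q' r' s'" "x \<in> L a" for p' q' r' s' x
  proof (rule wheel_rim_matched[of adj a p' q' r' s' L E x])
    have "p' \<in> {a, p', q', r', s'}" "q' \<in> {a, p', q', r', s'}" by auto
    then have "p' \<in> {a, p, q, r, s}" "q' \<in> {a, p, q, r, s}" using R(1) by simp_all
    then have pq: "p' \<in> {p, q, r, s}" "q' \<in> {p, q, r, s}" using R(1) by auto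
    show "N p' x \<in> L p'" "E x (N p' x)" "N q' x \<in> L q'" "E x (N q' x)" using N pq R(2) by blast+
    show "\<exists>y\<in>L q'. E w y" if "w \<in> L a" for w using spoke pq(2) that by blast
  qed (use R cov none card'[OF R(1)] in auto)
  have rim: "E (N p x) (N q x)" "E (N q x) (N r x)" "E (N r x) (N s x)" "E (N s x) (N p x)" if "x \<in> L a" for x
    using rot[THEN rim_rot, OF that] .
  have N_eq: "x = y" if "E x (N v y)" "v \<in> {p, q, r, s}" "x \<in> L a" "y \<in> L a" for v x y
    using c(4)[of v a "N v y" x y] c(3) N[OF that(2,4)] that d by auto
  obtain x1 x2 x3 where x: "L a = {x1, x2, x3}" "x1 \<noteq> x2" "x1 \<noteq> x3" "x2 \<noteq> x3" using card[of a] by (auto simp: card_3_iff)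
  have rim_ne: "\<not> E (N u x2) (N v x3)" if "E (N u x2) (N v x2)" "u \<in> {p, q, r, s}" "v \<in> {p, q, r, s}" "u \<noteq> v" for u v
  proof
    assume "E (N u x2) (N v x3)"
    then have "N v x3 = N v x2" using c(4)[of u v "N u x2" "N v x3" "N v x2"] N[of u x2] N[of v x2] N[of v x3] that x by auto
    then show False using N_eq[of x3 v x2] N[of v x3] that x by auto
  qed
  have E_sym: "\<not> E y x" if "\<not> E x y" for x y using that c(3) by blast
  have ne: "p \<noteq> q" "q \<noteq> r" "r \<noteq> s" "s \<noteq> p" using d by auto
  have "\<not> E x1 (N p x2)" "\<not> E x1 (N q x3)" "\<not> E x1 (N r x2)" "\<not> E x1 (N s x3)"
    using N_eq[of x1] x by auto
  moreover have "\<not> E (N p x2) (N q x3)" "\<not> E (N r x2) (N s x3)"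
    using rim_ne[of p q] rim_ne[of r s] rim[of x2] x ne by auto
  moreover have "\<not> E (N r x2) (N q x3)"
    by (rule rim_ne[OF c(3)[OF rim(2)]]) (use x ne in auto)
  moreover have "\<not> E (N p x2) (N s x3)"
    by (rule rim_ne[OF c(3)[OF rim(4)]]) (use x ne in auto)
  ultimately show False
    using wheel_transversalI[OF cov d nadj(1,3), of x1 "N p x2" "N q x3" "N r x2" "N s x3"] N x none E_sym by auto
qed

lemma transversal_wheel:
  assumes cov: "cover_on adj {a, p, q, r, s} L E" and d: "distinct [a, p, q, r, s]"
    and nadj: "\<not> adj p r" "\<not> adj r p" "\<not> adj q s" "\<not> adj s q"
    and card: "\<And>v. v \<in> {a, p, q, r, s} \<Longrightarrow> 3 \<le> card (L v)"
  shows "\<exists>h. transversal {a, p, q, r, s} L E h"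
proof -
  have "\<exists>S. S \<subseteq> L v \<and> card S = 3" if "v \<in> {a, p, q, r, s}" for v
    using obtain_subset_with_card_n[OF card[OF that]] by metis
  then have "\<forall>v\<in>{a, p, q, r, s}. \<exists>S. S \<subseteq> L v \<and> card S = 3" by blast
  from bchoice[OF this] obtain L' where L': "\<forall>v\<in>{a, p, q, r, s}. L' v \<subseteq> L v \<and> card (L' v) = 3" by blast
  have "cover_on adj {a, p, q, r, s} L' E" using L' by (intro cover_on_mono[OF cov]) auto
  then have "\<exists>h. transversal {a, p, q, r, s} L' E h"
    by (rule transversal_wheel_of_card_eq[OF _ d nadj]) (use L' in auto)
  then obtain h where "transversal {a, p, q, r, s} L' E h" by blast
  then have "transversal {a, p, q, r, s} L E h" using L' unfolding transversal_def by blast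
  then show ?thesis by blast
qed

text \<open>
  Coloured last, \<open>p\<close> has at most \<open>|V| - 2\<close> coloured neighbours; the others are coloured greedily.
\<close>
lemma transversal_of_non_adjacent_pair:
  assumes cov: "cover_on adj V L E" and pq: "p \<in> V" "q \<in> V" "p \<noteq> q" "\<not> adj q p"
    and card: "\<And>v. v \<in> V \<Longrightarrow> card V \<le> card (L v) + 1"
  shows "\<exists>h. transversal V L E h"
proof -
  note c = cover_onD[OF cov]
  have V: "card (V - {p}) + 1 = card V" using card_Suc_Diff1[OF c(1) pq(1)] by linarith
  have "card (V - {p} - {q}) + 1 = card (V - {p})" using card_Suc_Diff1[of "V - {p}" q] c(1) pq by auto
  moreover have "card {w \<in> V - {p}. adj w p} \<le> card (V - {p} - {q})" using c(1) pq by (intro card_mono) auto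
  ultimately have "card {w \<in> V - {p}. adj w p} < card (L p)" using V card[OF pq(1)] by linarith
  moreover have "\<exists>h. transversal (V - {p}) L E h"
  proof (rule transversal_greedy)
    show "cover_on adj (V - {p}) L E" by (rule cover_on_mono[OF cov]) auto
    show "card (V - {p}) \<le> card (L v)" if "v \<in> V - {p}" for v using card[of v] V that by simp
  qed
  ultimately show ?thesis using transversal_extend_last[OF cov pq(1)] by blast
qed

text \<open>
  A vertex with two non-neighbours can be coloured last, the rest containing a non-adjacent pair.
  Otherwise non-adjacent pairs are disjoint, and the hypothesis provides two of them. Colouring all but
  these four vertices and one hub greedily leaves lists of size three on a wheel.
\<close>
lemma transversal_or_four_cycle:
  assumes cov: "cover_on adj V L E" and sym: "symp adj"
    and card: "\<And>v. v \<in> V \<Longrightarrow> card V \<le> card (L v) + 2"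
    and pair: "\<And>p. p \<in> V \<Longrightarrow> \<exists>q\<in>V - {p}. \<exists>r\<in>V - {p}. q \<noteq> r \<and> \<not> adj q r" and ne: "V \<noteq> {}"
  shows "(\<exists>h. transversal V L E h) \<or>
    (\<exists>p q r s. distinct [p, q, r, s] \<and> V = {p, q, r, s} \<and> adj p q \<and> adj q r \<and> adj r s \<and> adj s p \<and> \<not> adj p r \<and> \<not> adj q s)"
proof (cases "\<exists>p\<in>V. \<exists>q\<in>V. \<exists>r\<in>V. distinct [p, q, r] \<and> \<not> adj p q \<and> \<not> adj p r")
  case True
  note c = cover_onD[OF cov]
  obtain p q r where p: "p \<in> V" "q \<in> V" "r \<in> V" "p \<noteq> q" "p \<noteq> r" "q \<noteq> r" "\<not> adj p q" "\<not> adj p r" using True by auto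
  have V: "card (V - {p}) + 1 = card V" using card_Suc_Diff1[OF c(1) p(1)] by linarith
  have "card {w \<in> V - {p}. adj w p} \<le> card (V - {p} - {q, r})"
    using c(1) p sympD[OF sym] by (intro card_mono) auto
  also have "\<dots> = card (V - {p}) - card {q, r}" using p by (intro card_Diff_subset) auto
  finally have "card {w \<in> V - {p}. adj w p} + 2 \<le> card (V - {p})"
    using card_mono[of "V - {p}" "{q, r}"] p c(1) by auto
  then have "card {w \<in> V - {p}. adj w p} < card (L p)" using V card[OF p(1)] by linarith
  moreover have "\<exists>h. transversal (V - {p}) L E h"
  proof -
    obtain x y where xy: "x \<in> V - {p}" "y \<in> V - {p}" "x \<noteq> y" "\<not> adj x y" using pair[OF p(1)] by blast
    show ?thesis
    proof (rule transversal_of_non_adjacent_pair[of adj _ _ _ y x])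
      show "cover_on adj (V - {p}) L E" by (rule cover_on_mono[OF cov]) auto
      show "card (V - {p}) \<le> card (L v) + 1" if "v \<in> V - {p}" for v using card[of v] V that by simp
    qed (use xy in auto)
  qed
  ultimately show ?thesis using transversal_extend_last[OF cov p(1)] by blast
next
  case False
  note c = cover_onD[OF cov]
  have one: "adj u w" if "u \<in> V" "v \<in> V" "w \<in> V" "\<not> adj u v" "u \<noteq> v" "u \<noteq> w" "v \<noteq> w" for u v w
    using False that by auto
  have sym': "adj v u \<longleftrightarrow> adj u v" for u v using sympD[OF sym] by blast
  obtain p r where pr: "p \<in> V" "r \<in> V" "p \<noteq> r" "\<not> adj p r" using pair ne by (metis DiffE ex_in_conv)
  obtain q s where qs: "q \<in> V" "s \<in> V" "q \<noteq> p" "s \<noteq> p" "q \<noteq> s" "\<not> adj q s" using pair[OF pr(1)] by blast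
  have d: "q \<noteq> r" "s \<noteq> r"
    using one[of r p s] one[of r p q] pr qs sym'[of r p] sym'[of q s] by metis+
  have nadj: "\<not> adj p r" "\<not> adj r p" "\<not> adj q s" "\<not> adj s q" using pr(4) qs(6) sym'[of p r] sym'[of q s] by simp_all
  let ?W = "{p, q, r, s}"
  have W: "?W \<subseteq> V" "card ?W = 4" using pr qs d by auto
  show ?thesis
  proof (cases "V = ?W")
    case True
    have "adj p q" "adj q r" "adj r s" "adj s p"
      using one[OF pr(1,2) qs(1)] one[OF qs(1,2) pr(2)] one[OF pr(2,1) qs(2)] one[OF qs(2,1) pr(1)] pr(3) qs(3-5) d nadj
      by auto
    then have "distinct [p, q, r, s] \<and> V = ?W \<and> adj p q \<and> adj q r \<and> adj r s \<and> adj s p \<and> \<not> adj p r \<and> \<not> adj q s"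
      using True pr(3) qs(3-5) d nadj by auto
    then show ?thesis by (intro disjI2 exI)
  next
    case False
    then obtain a where a: "a \<in> V" "a \<notin> ?W" using W(1) by blast
    let ?C = "V - {a, p, q, r, s}"
    have 5: "card ?C + 5 = card V"
    proof -
      have "card {a, p, q, r, s} = 5" using W(2) a(2) by simp
      moreover have "{a, p, q, r, s} \<subseteq> V" using W(1) a(1) by auto
      ultimately show ?thesis
        using card_Diff_subset[of "{a, p, q, r, s}" V] card_mono[OF c(1), of "{a, p, q, r, s}"] by simp
    qed
    obtain g where g: "transversal ?C L E g"
    proof -
      have "cover_on adj ?C L E" by (rule cover_on_mono[OF cov]) auto
      moreover have "card ?C \<le> card (L v)" if "v \<in> ?C" for v using card[of v] 5 that by simp
      ultimately show ?thesis using transversal_greedy[of adj ?C L E] that by blast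
    qed
    have "\<exists>h. transversal {a, p, q, r, s} (residual L E ?C g) E h"
    proof (rule transversal_wheel[of adj a p q r s])
      show "cover_on adj {a, p, q, r, s} (residual L E ?C g) E"
        using W(1) a(1) by (intro cover_on_residual[OF cov]) auto
      show "distinct [a, p, q, r, s]" using a pr qs d by auto
      fix v assume "v \<in> {a, p, q, r, s}"
      then have v: "v \<in> V" "v \<notin> ?C" using W(1) a(1) by auto
      have "card (killed L E ?C g v) \<le> card {w \<in> ?C. adj w v}"
        by (rule card_killed_le[OF cov]) (use v g in \<open>auto simp: transversal_def\<close>)
      also have "\<dots> \<le> card ?C" using c(1) by (intro card_mono) auto
      finally show "3 \<le> card (residual L E ?C g v)"
        using card_residual[of L v E ?C g] c(2)[OF v(1)] card[OF v(1)] 5 by linarith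
    qed (fact nadj)+
    moreover have "V - ?C = {a, p, q, r, s}" using W(1) a(1) by auto
    ultimately have "\<exists>h. transversal V L E h" using transversal_extend[OF cov _ _ g] by blast
    then show ?thesis ..
  qed
qed

section \<open>DP-chromatic and chromatic number\<close>

abbreviation adjacent :: "'a ugraph \<Rightarrow> 'a \<Rightarrow> 'a \<Rightarrow> bool" where
  "adjacent G u v \<equiv> {u, v} \<in> edges G"

lemma symp_adjacent: "symp (adjacent G)"
  by (simp add: symp_def insert_commute)

lemma edge_verts:
  assumes "fin_graph G" "{u, v} \<in> edges G"
  shows "u \<in> verts G" "v \<in> verts G" "u \<noteq> v"
proof -
  have "{u, v} \<in> [verts G]\<^bsup>2\<^esup>" using assms unfolding fin_graph_def by blast
  then have sub: "{u, v} \<subseteq> verts G" "card {u, v} = 2" unfolding nsets_def by blast+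
  show "u \<in> verts G" "v \<in> verts G" using sub(1) by auto
  show "u \<noteq> v" using sub(2) by auto
qed

lemma cover_on_of_is_cover:
  assumes G: "fin_graph G" and H: "is_cover G L H"
  shows "cover_on (adjacent G) (verts G) L (adjacent H)"
proof -
  note c = H[unfolded is_cover_def]
  have "finite (verts H)" using c by (simp add: fin_graph_def)
  then have "finite (L v)" if "v \<in> verts G" for v
    using c that finite_subset[of "L v" "verts H"] by blast
  moreover have "y = y'"
    if "p \<in> verts G" "q \<in> verts G" "p \<noteq> q" "x \<in> L p" "y \<in> L q" "y' \<in> L q" "adjacent H x y" "adjacent H x y'"
    for p q x y y'
  proof -
    have e: "{x, y} \<in> edges_between H (L p) (L q)" "{x, y'} \<in> edges_between H (L p) (L q)"
      using that by (auto simp: edges_between_def)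
    then have "adjacent G p q" using c that(1-3) by (metis empty_iff)
    then have "disjoint (edges_between H (L p) (L q))" using c that(1,2) by blast
    then have "{x, y} = {x, y'}" using e by (metis disjointD disjoint_iff insertI1)
    then show ?thesis by (auto simp: doubleton_eq_iff)
  qed
  moreover have "\<not> adjacent H x y"
    if "p \<in> verts G" "q \<in> verts G" "p \<noteq> q" "\<not> adjacent G p q" "x \<in> L p" "y \<in> L q" for p q x y
  proof -
    have "edges_between H (L p) (L q) = {}" using c that(1-4) by blast
    then show ?thesis using that(5,6) by (auto simp: edges_between_def)
  qed
  ultimately show ?thesis
    using G symp_adjacent[of H] unfolding cover_on_def fin_graph_def by blast
qed

lemma DP_fold_colorableI:
  fixes G :: "'a ugraph"
  assumes G: "fin_graph G"
    and tr: "\<And>(L :: 'a \<Rightarrow> nat set) E. cover_on (adjacent G) (verts G) L E \<Longrightarrow>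
      (\<And>v. v \<in> verts G \<Longrightarrow> card (L v) = r) \<Longrightarrow> \<exists>h. transversal (verts G) L E h"
  shows "DP_fold_colorable G r"
  unfolding DP_fold_colorable_def
proof (intro allI impI)
  fix L :: "'a \<Rightarrow> nat set" and H
  assume "fold_cover r G L H"
  then have H: "is_cover G L H" "\<And>v. v \<in> verts G \<Longrightarrow> card (L v) = r" by (auto simp: fold_cover_def)
  obtain h where h: "transversal (verts G) L (adjacent H) h"
    using tr[OF cover_on_of_is_cover[OF G H(1)] H(2)] by blast
  have inj: "inj_on h (verts G)"
  proof (rule inj_onI, rule ccontr)
    fix u v assume uv: "u \<in> verts G" "v \<in> verts G" "h u = h v" "u \<noteq> v"
    have "disjoint_family_on L (verts G)" using H(1) by (simp add: is_cover_def)
    then have "L u \<inter> L v = {}" using uv by (simp add: disjoint_family_on_def)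
    moreover have "h u \<in> L u" "h v \<in> L v" using h uv(1,2) by (simp_all add: transversal_def)
    ultimately show False using uv(3) by auto
  qed
  have "indep (h ` verts G) (edges H)"
    using h by (auto simp: indep_def transversal_def)
  moreover have "h ` verts G \<subseteq> verts H" using h H(1) unfolding transversal_def is_cover_def by blast
  ultimately show "cover_colorable G H"
    unfolding cover_colorable_def using card_image[OF inj] by blast
qed

text \<open>
  The cover whose lists are copies of \<open>{..<r}\<close> and whose matching along the edge \<open>uv\<close> is the partial
  bijection \<open>R u v\<close>. Lower bounds come from particular choices of \<open>R\<close>: the identity matchings encode
  ordinary colouring, and a single twist defeats the four-cycle.
\<close>
lemma ex_coloring_of_DP_fold_colorable:
  assumes G: "fin_graph G" and DP: "DP_fold_colorable G r"
    and sym: "\<And>u v i j. R u v i j \<Longrightarrow> R v u j i"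
    and match: "\<And>u v i j j'. R u v i j \<Longrightarrow> R u v i j' \<Longrightarrow> j = j'"
  shows "\<exists>c. c ` verts G \<subseteq> {..<r} \<and> (\<forall>u v. adjacent G u v \<longrightarrow> \<not> R u v (c u) (c v))"
proof -
  let ?P = "\<lambda>(u, i) (v, j). u \<in> verts G \<and> v \<in> verts G \<and> i < r \<and> j < r \<and>
    (u = v \<and> i \<noteq> j \<or> adjacent G u v \<and> R u v i j)"
  define H where "H = \<lparr>verts = verts G \<times> {..<r}, edges = {{x, y} |x y. ?P x y}\<rparr>"
  define L where "L u = {u} \<times> {..<r}" for u :: 'a
  have Psym: "?P x y \<Longrightarrow> ?P y x" for x y
    using sym by (auto simp: insert_commute)
  have adj_iff: "adjacent H x y \<longleftrightarrow> ?P x y" for x y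
  proof
    assume "adjacent H x y"
    then obtain x' y' where xy: "{x, y} = {x', y'}" "?P x' y'" by (auto simp: H_def)
    then consider "x = x'" "y = y'" | "x = y'" "y = x'" by (auto simp: doubleton_eq_iff)
    then show "?P x y" using xy(2) Psym[of x' y'] by cases simp_all
  qed (use H_def in auto)
  have "{u} \<notin> edges G" for u using edge_verts(3)[OF G, of u u] by auto
  then have irrefl: "\<not> ?P x x" for x by auto
  have H1: "fin_graph H"
  proof -
    have pair: "{x, y} \<in> [verts G \<times> {..<r}]\<^bsup>2\<^esup>" if "?P x y" for x y
    proof -
      have "x \<noteq> y" using that irrefl by metis
      moreover have "x \<in> verts G \<times> {..<r}" "y \<in> verts G \<times> {..<r}" using that by auto
      ultimately show ?thesis by (simp add: nsets_def)
    qed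
    have "edges H \<subseteq> [verts H]\<^bsup>2\<^esup>"
    proof
      fix e assume "e \<in> edges H"
      then obtain x y where "e = {x, y}" "?P x y" unfolding H_def ugraph.simps by blast
      then show "e \<in> [verts H]\<^bsup>2\<^esup>" using pair by (simp add: H_def)
    qed
    then show ?thesis using G by (simp add: fin_graph_def H_def)
  qed
  have between: "\<exists>i j. e = {(u, i), (v, j)} \<and> ?P (u, i) (v, j)" if "e \<in> edges_between H (L u) (L v)" for e u v
  proof -
    obtain x y where "x \<in> L u" "y \<in> L v" "e = {x, y}" "adjacent H x y"
      using \<open>e \<in> _\<close> unfolding edges_between_def by blast
    then show ?thesis unfolding adj_iff by (auto simp: L_def)
  qed
  have "fold_cover r G L H"
    unfolding fold_cover_def is_cover_def
  proof (intro conjI ballI impI)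
    show "disjoint_family_on L (verts G)" by (auto simp: disjoint_family_on_def L_def)
    show "clique (L u) (edges H)" if "u \<in> verts G" for u
      using that unfolding clique_def adj_iff by (auto simp: L_def)
    show "edges_between H (L u) (L v) = {}" if "u \<noteq> v \<and> \<not> adjacent G u v" for u v
      using between[of _ u v] that by auto
    show "disjoint (edges_between H (L u) (L v))" if uv: "adjacent G u v" for u v
    proof (rule disjointI)
      fix e e' assume e: "e \<in> edges_between H (L u) (L v)" "e' \<in> edges_between H (L u) (L v)" "e \<noteq> e'"
      have "u \<noteq> v" using edge_verts[OF G uv] by simp
      obtain i j where ij: "e = {(u, i), (v, j)}" "?P (u, i) (v, j)" using between[OF e(1)] by blast
      obtain i' j' where ij': "e' = {(u, i'), (v, j')}" "?P (u, i') (v, j')" using between[OF e(2)] by blast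
      have R: "R u v i j" "R u v i' j'" using ij ij' \<open>u \<noteq> v\<close> by auto
      have "j = j'" if "i = i'" using match[of u v i j j'] R that by simp
      moreover have "i = i'" if "j = j'" using match[of v u j i i'] sym[OF R(1)] sym[OF R(2)] that by simp
      ultimately have "i \<noteq> i'" "j \<noteq> j'" using e(3) ij(1) ij'(1) by auto
      then show "e \<inter> e' = {}" using ij ij' \<open>u \<noteq> v\<close> by auto
    qed
  qed (use H1 in \<open>auto simp: L_def H_def\<close>)
  then have "cover_colorable G H" by (rule DP_fold_colorable_cover[OF DP])
  then obtain I where "I \<subseteq> verts H" and I': "indep I (edges H)" "card I = card (verts G)"
    unfolding cover_colorable_def by blast
  then have I: "I \<subseteq> verts G \<times> {..<r}" by (simp add: H_def)
  have fin: "finite (verts G)" using G by (simp add: fin_graph_def)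
  have noP: "\<not> ?P x y" if "x \<in> I" "y \<in> I" "x \<noteq> y" for x y
    using I'(1) that adj_iff[of x y] unfolding indep_def by blast
  have "inj_on fst I"
  proof (rule inj_onI, rule ccontr)
    fix x y assume xy: "x \<in> I" "y \<in> I" "fst x = fst y" "x \<noteq> y"
    then have "snd x \<noteq> snd y" by (simp add: prod_eq_iff)
    moreover have "fst x \<in> verts G" "snd x < r" "snd y < r" using I xy(1,2) by auto
    ultimately have "?P x y" using xy(3) by (auto simp: case_prod_beta)
    then show False using noP xy by blast
  qed
  then have "card (fst ` I) = card (verts G)" using I'(2) card_image by metis
  moreover have "fst ` I \<subseteq> verts G" using I by auto
  ultimately have "fst ` I = verts G" using fin by (metis card_subset_eq)
  then have "\<forall>u\<in>verts G. \<exists>i. (u, i) \<in> I" by force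
  then obtain c where c: "\<And>u. u \<in> verts G \<Longrightarrow> (u, c u) \<in> I" by metis
  have "\<not> R u v (c u) (c v)" if "adjacent G u v" for u v
  proof
    assume R: "R u v (c u) (c v)"
    have uv: "u \<in> verts G" "v \<in> verts G" "u \<noteq> v" using edge_verts[OF G that] by simp_all
    then have "?P (u, c u) (v, c v)" using R that c I by auto
    then show False using noP[OF c[OF uv(1)] c[OF uv(2)]] uv(3) by auto
  qed
  moreover have "c ` verts G \<subseteq> {..<r}" using c I by blast
  ultimately show ?thesis by blast
qed

lemma colorable_of_DP_fold_colorable:
  assumes "fin_graph G" "DP_fold_colorable G r"
  shows "colorable G r"
  using ex_coloring_of_DP_fold_colorable[OF assms, of "\<lambda>_ _ i j. i = j"] unfolding colorable_def by blast

lemma DP_fold_colorable_card: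
  assumes "fin_graph G"
  shows "DP_fold_colorable G (card (verts G))"
  by (rule DP_fold_colorableI[OF assms]) (auto intro: transversal_greedy)

lemma chromatic_number_pos:
  assumes "verts G \<noteq> {}" "colorable G k"
  shows "0 < chromatic_number G"
proof -
  have "colorable G (chromatic_number G)" unfolding chromatic_number_def using assms(2) by (rule LeastI)
  then show ?thesis using assms(1) by (auto simp: colorable_def intro: gr0I)
qed

text \<open>
  The DP-chromatic number is at least the chromatic number, so both agree as soon as the smaller value
  works.
\<close>
lemma DP_chromatic_number_eq_iff:
  assumes G: "fin_graph G" and ne: "verts G \<noteq> {}"
  shows "DP_chromatic_number G = chromatic_number G \<longleftrightarrow> DP_fold_colorable G (chromatic_number G)"
proof -
  let ?n = "card (verts G)"
  have n: "0 < ?n" using G ne by (simp add: fin_graph_def card_gt_0_iff)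
  have DP: "DP_fold_colorable G (DP_chromatic_number G)"
    using LeastI[of "\<lambda>r. 0 < r \<and> DP_fold_colorable G r" ?n] n DP_fold_colorable_card[OF G]
    unfolding DP_chromatic_number_def by blast
  then have le: "chromatic_number G \<le> DP_chromatic_number G"
    unfolding chromatic_number_def by (intro Least_le colorable_of_DP_fold_colorable[OF G])
  have "DP_chromatic_number G \<le> chromatic_number G" if "DP_fold_colorable G (chromatic_number G)"
    unfolding DP_chromatic_number_def
    using that chromatic_number_pos[OF ne colorable_of_DP_fold_colorable[OF G DP]] by (intro Least_le) simp
  then show ?thesis using DP le by fastforce
qed

section \<open>Joins with complete graphs\<close>

lemma adjacent_complete_graph: "adjacent (complete_graph s) i j \<longleftrightarrow> i < s \<and> j < s \<and> i \<noteq> j"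
proof
  assume "adjacent (complete_graph s) i j"
  then have "{i, j} \<subseteq> {..<s}" "card {i, j} = 2" unfolding complete_graph_def nsets_def ugraph.simps by blast+
  then show "i < s \<and> j < s \<and> i \<noteq> j" by auto
qed (simp add: complete_graph_def nsets_def)

lemma fin_graph_complete_graph: "fin_graph (complete_graph s)"
  by (simp add: fin_graph_def complete_graph_def)

lemma verts_complete_graph: "verts (complete_graph s) = {..<s}"
  by (simp add: complete_graph_def)

lemma verts_join: "verts (join G H) = Inl ` verts G \<union> Inr ` verts H"
  by (auto simp: join_def)

lemma adjacent_join:
  fixes G :: "'a ugraph" and H :: "'b ugraph"
  shows "adjacent (join G H) (Inl u) (Inl v) \<longleftrightarrow> adjacent G u v"
  "adjacent (join G H) (Inr x) (Inr y) \<longleftrightarrow> adjacent H x y"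
  "adjacent (join G H) (Inl u) (Inr x) \<longleftrightarrow> u \<in> verts G \<and> x \<in> verts H"
proof -
  have inl: "{Inl u, Inl v} = (Inl ` e :: ('a + 'b) set) \<longleftrightarrow> e = {u, v}" for e u v
    using inj_image_eq_iff[of "Inl :: 'a \<Rightarrow> 'a + 'b" e "{u, v}"] by auto
  have inr: "{Inr u, Inr v} = (Inr ` e :: ('a + 'b) set) \<longleftrightarrow> e = {u, v}" for e u v
    using inj_image_eq_iff[of "Inr :: 'b \<Rightarrow> 'a + 'b" e "{u, v}"] by auto
  have "insert (Inl u) A \<noteq> Inr ` e" for e :: "'b set" and u :: 'a and A by blast
  moreover have "insert (Inr u) A \<noteq> Inl ` e" for e :: "'a set" and u :: 'b and A by blast
  moreover have "{Inl u, Inr x} \<noteq> Inl ` e" for e :: "'a set" and u :: 'a and x :: 'b by blast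
  ultimately show "adjacent (join G H) (Inl u) (Inl v) \<longleftrightarrow> adjacent G u v"
    "adjacent (join G H) (Inr x) (Inr y) \<longleftrightarrow> adjacent H x y"
    "adjacent (join G H) (Inl u) (Inr x) \<longleftrightarrow> u \<in> verts G \<and> x \<in> verts H"
    unfolding join_def by (auto simp: image_iff inl inr doubleton_eq_iff)
qed

lemma fin_graph_join:
  assumes "fin_graph G" "fin_graph H"
  shows "fin_graph (join G H)"
proof -
  have G: "finite (verts G)" "\<And>e. e \<in> edges G \<Longrightarrow> e \<subseteq> verts G \<and> finite e \<and> card e = 2"
    and H: "finite (verts H)" "\<And>e. e \<in> edges H \<Longrightarrow> e \<subseteq> verts H \<and> finite e \<and> card e = 2"
    using assms by (auto simp: fin_graph_def nsets_def)
  have "Inl ` e \<in> [verts (join G H)]\<^bsup>2\<^esup>" if "e \<in> edges G" for e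
    using G(2)[OF that] by (auto simp: nsets_def verts_join card_image)
  moreover have "Inr ` e \<in> [verts (join G H)]\<^bsup>2\<^esup>" if "e \<in> edges H" for e
    using H(2)[OF that] by (auto simp: nsets_def verts_join card_image)
  moreover have "{Inl u, Inr v} \<in> [verts (join G H)]\<^bsup>2\<^esup>" if "u \<in> verts G" "v \<in> verts H" for u v
    using that by (auto simp: nsets_def verts_join)
  ultimately have "edges (join G H) \<subseteq> [verts (join G H)]\<^bsup>2\<^esup>"
    unfolding join_def by auto
  then show ?thesis using G(1) H(1) by (simp add: fin_graph_def verts_join)
qed

lemma colorable_chromatic_number:
  assumes "fin_graph G"
  shows "colorable G (chromatic_number G)"
  unfolding chromatic_number_def
  using colorable_of_DP_fold_colorable[OF assms DP_fold_colorable_card[OF assms]] by (rule LeastI)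

lemma colorable_join_complete_graph:
  assumes "colorable G k"
  shows "colorable (join G (complete_graph s)) (k + s)"
proof -
  obtain c where c: "c ` verts G \<subseteq> {..<k}" "\<And>u v. adjacent G u v \<Longrightarrow> c u \<noteq> c v"
    using assms unfolding colorable_def by blast
  define d where "d = case_sum c (\<lambda>i. k + i)"
  have "d ` verts (join G (complete_graph s)) \<subseteq> {..<k + s}"
    using c(1) by (auto simp: d_def verts_join verts_complete_graph)
  moreover have "d x \<noteq> d y" if "adjacent (join G (complete_graph s)) x y" for x y
  proof (cases x; cases y)
    fix u v assume xy: "x = Inl u" "y = Inl v"
    then show ?thesis using that c(2)[of u v] by (simp add: adjacent_join d_def)
  next
    fix u i assume xy: "x = Inl u" "y = Inr i"
    then have "c u < k" using that c(1) by (auto simp: adjacent_join)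
    then show ?thesis using xy by (simp add: d_def)
  next
    fix u i assume xy: "x = Inr i" "y = Inl u"
    then have "c u < k" using that c(1) by (auto simp: adjacent_join insert_commute[of "Inr i"])
    then show ?thesis using xy by (simp add: d_def)
  next
    fix i j assume xy: "x = Inr i" "y = Inr j"
    then show ?thesis using that by (auto simp: adjacent_join adjacent_complete_graph d_def)
  qed
  ultimately show ?thesis unfolding colorable_def by blast
qed

text \<open>
  The vertices of \<open>K\<^sub>s\<close> use up \<open>s\<close> colours that do not occur on \<open>G\<close>; the bijection \<open>\<pi>\<close> renumbers the others.
\<close>
lemma colorable_of_join_complete_graph:
  assumes "colorable (join G (complete_graph s)) r"
  shows "s \<le> r" "fin_graph G \<Longrightarrow> colorable G (r - s)"
proof -
  let ?J = "join G (complete_graph s)"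
  obtain d where d: "d ` verts ?J \<subseteq> {..<r}" "\<And>x y. adjacent ?J x y \<Longrightarrow> d x \<noteq> d y"
    using assms unfolding colorable_def by blast
  let ?D = "(\<lambda>i. d (Inr i)) ` {..<s}"
  have "inj_on (\<lambda>i. d (Inr i)) {..<s}"
  proof (rule inj_onI, rule ccontr)
    fix i j assume "i \<in> {..<s}" "j \<in> {..<s}" "d (Inr i) = d (Inr j)" "i \<noteq> j"
    then show False using d(2)[of "Inr i" "Inr j"] by (simp add: adjacent_join adjacent_complete_graph)
  qed
  then have D: "card ?D = s" by (simp add: card_image)
  have sub: "?D \<subseteq> {..<r}" using d(1) by (auto simp: verts_join verts_complete_graph)
  show "s \<le> r" using card_mono[OF _ sub] D by simp
  have "card ({..<r} - ?D) = card {..<r - s}" using D sub by (simp add: card_Diff_subset)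
  then obtain \<pi> where \<pi>: "bij_betw \<pi> ({..<r} - ?D) {..<r - s}"
    using finite_same_card_bij[of "{..<r} - ?D" "{..<r - s}"] by auto
  assume G: "fin_graph G"
  have mem: "d (Inl u) \<in> {..<r} - ?D" if u: "u \<in> verts G" for u
  proof -
    have "d (Inl u) \<noteq> d (Inr i)" if "i < s" for i
      using u that d(2)[of "Inl u" "Inr i"] by (simp add: adjacent_join verts_complete_graph)
    then show ?thesis using u d(1) by (auto simp: verts_join)
  qed
  have "\<pi> (d (Inl u)) \<noteq> \<pi> (d (Inl v))" if "adjacent G u v" for u v
  proof -
    have "u \<in> verts G" "v \<in> verts G" using edge_verts[OF G that] by auto
    moreover have "d (Inl u) \<noteq> d (Inl v)" using d(2)[of "Inl u" "Inl v"] that by (simp add: adjacent_join)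
    ultimately show ?thesis using \<pi> mem by (metis bij_betw_def inj_onD)
  qed
  moreover have "(\<lambda>u. \<pi> (d (Inl u))) ` verts G \<subseteq> {..<r - s}"
    using \<pi> mem by (auto dest: bij_betwE)
  ultimately show "colorable G (r - s)"
    unfolding colorable_def by (intro exI[of _ "\<lambda>u. \<pi> (d (Inl u))"]) blast
qed

lemma chromatic_number_join_complete_graph:
  assumes "fin_graph G"
  shows "chromatic_number (join G (complete_graph s)) = chromatic_number G + s"
proof (rule antisym)
  let ?J = "join G (complete_graph s)"
  show "chromatic_number ?J \<le> chromatic_number G + s"
    unfolding chromatic_number_def[of ?J]
    using colorable_join_complete_graph[OF colorable_chromatic_number[OF assms]] by (rule Least_le)
  have "colorable ?J (chromatic_number ?J)"
    by (intro colorable_chromatic_number fin_graph_join assms fin_graph_complete_graph)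
  note r = colorable_of_join_complete_graph[OF this]
  have "chromatic_number G \<le> chromatic_number ?J - s"
    unfolding chromatic_number_def[of G] using r(2)[OF assms] by (rule Least_le)
  then show "chromatic_number G + s \<le> chromatic_number ?J" using r(1) by linarith
qed

lemma Z_DP_eq_Least:
  assumes "fin_graph G" "verts G \<noteq> {}"
  shows "Z_DP G = (LEAST s. DP_fold_colorable (join G (complete_graph s)) (chromatic_number G + s))"
proof -
  have "DP_chromatic_number (join G (complete_graph s)) = chromatic_number (join G (complete_graph s)) \<longleftrightarrow>
      DP_fold_colorable (join G (complete_graph s)) (chromatic_number G + s)" for s
    using DP_chromatic_number_eq_iff[of "join G (complete_graph s)"] assms
    unfolding chromatic_number_join_complete_graph[OF assms(1)]
    by (simp add: fin_graph_join fin_graph_complete_graph verts_join)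
  then show ?thesis unfolding Z_DP_def by simp
qed

text \<open>
  Handshaking: every edge is counted at its two ends.
\<close>
lemma sum_degree_le:
  assumes "fin_graph G"
  shows "(\<Sum>u\<in>verts G. card {w \<in> verts G. adjacent G u w}) \<le> 2 * card (edges G)"
proof -
  have fin: "finite (verts G)" and E: "edges G \<subseteq> [verts G]\<^bsup>2\<^esup>" using assms by (auto simp: fin_graph_def)
  have finE: "finite (edges G)" using finite_subset[OF E] fin by (simp add: finite_imp_finite_nsets)
  have "card {w \<in> verts G. adjacent G u w} \<le> card {e \<in> edges G. u \<in> e}" for u
  proof (rule card_inj_on_le)
    show "inj_on (\<lambda>w. {u, w}) {w \<in> verts G. adjacent G u w}" by (auto simp: inj_on_def doubleton_eq_iff)
  qed (use finE in auto)
  then have "(\<Sum>u\<in>verts G. card {w \<in> verts G. adjacent G u w}) \<le> (\<Sum>u\<in>verts G. card {e \<in> edges G. u \<in> e})"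
    by (rule sum_mono)
  also have "\<dots> = 2 * card (edges G)"
  proof (rule sum_multicount[OF fin finE], intro ballI)
    fix e assume "e \<in> edges G"
    then have "e \<subseteq> verts G" "card e = 2" using E by (auto simp: nsets_def)
    then show "card {u \<in> verts G. u \<in> e} = 2" by (metis Collect_mem_eq inf.absorb2 Collect_conj_eq)
  qed
  finally show ?thesis .
qed

text \<open>
  With lists of size \<open>k + s\<close>, the demand of a vertex of \<open>G\<close> is its degree plus \<open>1 - k\<close>, hence at most its degree.
\<close>
lemma DP_fold_colorable_join_complete_graph:
  assumes G: "fin_graph G" "verts G \<noteq> {}" and s: "2 * card (edges G) \<le> s"
  shows "DP_fold_colorable (join G (complete_graph s)) (chromatic_number G + s)"
proof (rule DP_fold_colorableI)
  let ?J = "join G (complete_graph s)" and ?k = "chromatic_number G"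
  let ?A = "Inr ` {..<s} :: ('a + nat) set" and ?U = "Inl ` verts G :: ('a + nat) set"
  show "fin_graph ?J" by (intro fin_graph_join G fin_graph_complete_graph)
  fix L :: "'a + nat \<Rightarrow> nat set" and E
  assume cov: "cover_on (adjacent ?J) (verts ?J) L E" and card: "\<And>v. v \<in> verts ?J \<Longrightarrow> card (L v) = ?k + s"
  have V: "verts ?J = ?A \<union> ?U" by (auto simp: verts_join verts_complete_graph)
  have cardA: "card ?A = s" by (simp add: card_image)
  obtain c where c: "c ` verts G \<subseteq> {..<?k}" "\<And>u v. adjacent G u v \<Longrightarrow> c u \<noteq> c v"
    using colorable_chromatic_number[OF G(1)] unfolding colorable_def by blast
  have k: "1 \<le> ?k" using chromatic_number_pos[OF G(2) colorable_chromatic_number[OF G(1)]] by simp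
  have "\<exists>h. transversal (?A \<union> ?U) L E h"
  proof (rule transversal_of_demand_le[OF symp_adjacent])
    show "cover_on (adjacent ?J) (?A \<union> ?U) L E" using cov V by simp
    show "?A \<inter> ?U = {}" by auto
    show "\<forall>u\<in>?U. \<forall>w\<in>?U. adjacent ?J u w \<longrightarrow> case_sum c (\<lambda>_. 0) u \<noteq> case_sum c (\<lambda>_. 0) w"
      using c(2) by (auto simp: adjacent_join)
    have "case_sum c (\<lambda>_. 0) ` ?U = c ` verts G" by (simp add: image_image)
    then show "card (case_sum c (\<lambda>_. 0) ` ?U) \<le> ?k" using card_mono[OF _ c(1)] by simp
    show "\<forall>a\<in>?A. card ?A + ?k \<le> card (L a)" using card V cardA by simp
    have "demand (adjacent ?J) ?A ?U L (Inl u) \<le> card {w \<in> verts G. adjacent G u w}" if "u \<in> verts G" for u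
    proof -
      have "{w \<in> ?U. adjacent ?J (Inl u) w} = Inl ` {w \<in> verts G. adjacent G u w}"
        by (auto simp: adjacent_join)
      moreover have "card (L (Inl u)) = ?k + s" using card V that by blast
      ultimately show ?thesis using k cardA by (simp add: demand_def card_image)
    qed
    then have "(\<Sum>u\<in>?U. demand (adjacent ?J) ?A ?U L u) \<le> (\<Sum>u\<in>verts G. card {w \<in> verts G. adjacent G u w})"
      by (simp add: sum.reindex sum_mono)
    then show "(\<Sum>u\<in>?U. demand (adjacent ?J) ?A ?U L u) \<le> card ?A"
      using sum_degree_le[OF G(1)] s cardA by linarith
  qed
  then show "\<exists>h. transversal (verts ?J) L E h" using V by simp
qed

lemma Z_DP_le:
  assumes "fin_graph G" "verts G \<noteq> {}"
  shows "Z_DP G \<le> 2 * card (edges G)"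
  unfolding Z_DP_eq_Least[OF assms] by (rule Least_le) (rule DP_fold_colorable_join_complete_graph[OF assms order_refl])

text \<open>
  Transfers colourability along the relabelling by which \<open>G\<close> sits inside its join with \<open>K\<^sub>0\<close>.
\<close>
lemma DP_fold_colorable_join_null:
  fixes G :: "'a ugraph"
  assumes G: "fin_graph G"
    and tr: "\<And>(L :: 'a \<Rightarrow> nat set) E. cover_on (adjacent G) (verts G) L E \<Longrightarrow>
      (\<And>v. v \<in> verts G \<Longrightarrow> card (L v) = r) \<Longrightarrow> \<exists>h. transversal (verts G) L E h"
  shows "DP_fold_colorable (join G (complete_graph 0)) r"
proof (rule DP_fold_colorableI)
  let ?J = "join G (complete_graph 0)"
  show "fin_graph ?J" by (intro fin_graph_join G fin_graph_complete_graph)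
  fix L :: "'a + nat \<Rightarrow> nat set" and E
  assume cov: "cover_on (adjacent ?J) (verts ?J) L E" and card: "\<And>v. v \<in> verts ?J \<Longrightarrow> card (L v) = r"
  have V: "verts ?J = Inl ` verts G" by (simp add: verts_join verts_complete_graph)
  have "cover_on (adjacent G) (verts G) (\<lambda>v. L (Inl v)) E"
    using cov G unfolding cover_on_def V by (simp add: fin_graph_def adjacent_join)
  then obtain h where "transversal (verts G) (\<lambda>v. L (Inl v)) E h" using tr[of "\<lambda>v. L (Inl v)" E] card V by blast
  then have "transversal (verts ?J) L E (\<lambda>v. h (projl v))" unfolding V transversal_def by auto
  then show "\<exists>h. transversal (verts ?J) L E h" by blast
qed

section \<open>Small complements and the four-cycle\<close>

lemma edges_cycle_graph_four: "edges (cycle_graph 4) = {{0, 1}, {1, 2}, {2, 3}, {3, 0}}"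
proof -
  have "{..<4} = {0, 1, 2, 3 :: nat}" by auto
  moreover have "edges (cycle_graph 4) = (\<lambda>i. {i, (i + 1) mod 4}) ` {..<4}"
    by (auto simp: cycle_graph_def)
  moreover have "(0 + 1) mod 4 = (1 :: nat)" "(1 + 1) mod 4 = (2 :: nat)" "(2 + 1) mod 4 = (3 :: nat)" "(3 + 1) mod 4 = (0 :: nat)"
    by simp_all
  ultimately show ?thesis by (simp only: image_insert image_empty)
qed

lemma graph_iso_four_cycleI:
  assumes d: "distinct [p, q, r, s]" and V: "verts G = {p, q, r, s}" and G: "fin_graph G"
    and adj: "adjacent G p q" "adjacent G q r" "adjacent G r s" "adjacent G s p"
    and nadj: "\<not> adjacent G p r" "\<not> adjacent G q s"
  shows "graph_iso G (cycle_graph 4)"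
proof -
  define f where "f x = (if x = p then 0 else if x = q then 1 else if x = r then 2 else 3 :: nat)" for x
  have f: "f p = 0" "f q = 1" "f r = 2" "f s = 3" using d by (auto simp: f_def)
  have "bij_betw f (verts G) (verts (cycle_graph 4))"
    unfolding bij_betw_def inj_on_def V using f by (auto simp: cycle_graph_def)
  moreover have "adjacent G u v \<longleftrightarrow> adjacent (cycle_graph 4) (f u) (f v)" if "u \<in> {p, q, r, s}" "v \<in> {p, q, r, s}" for u v
  proof -
    have sym: "{q, p} = {p, q}" "{r, p} = {p, r}" "{s, p} = {p, s}" "{r, q} = {q, r}" "{s, q} = {q, s}" "{s, r} = {r, s}"
      by auto
    have "{x} \<notin> edges G" for x using edge_verts(3)[OF G, of x x] by auto
    then show ?thesis
      using that adj nadj f unfolding edges_cycle_graph_four sym by (auto simp: doubleton_eq_iff sym)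
  qed
  ultimately show ?thesis unfolding graph_iso_def V by blast
qed

lemma four_cycle_of_graph_iso:
  assumes "graph_iso G (cycle_graph 4)"
  obtains p q r s where "distinct [p, q, r, s]" "verts G = {p, q, r, s}"
    "adjacent G p q" "adjacent G q r" "adjacent G r s" "adjacent G s p" "\<not> adjacent G p r" "\<not> adjacent G q s"
proof -
  obtain f where f: "bij_betw f (verts G) {..<4}"
    and adj: "\<And>u v. u \<in> verts G \<Longrightarrow> v \<in> verts G \<Longrightarrow> adjacent G u v \<longleftrightarrow> adjacent (cycle_graph 4) (f u) (f v)"
    using assms by (auto simp: graph_iso_def cycle_graph_def)
  define g where "g = inv_into (verts G) f"
  have g: "bij_betw g {..<4} (verts G)" unfolding g_def using f by (rule bij_betw_inv_into)
  have fg: "f (g i) = i" if "i < 4" for i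
    using that f unfolding g_def by (simp add: bij_betw_inv_into_right)
  have "{..<4} = {0, 1, 2, 3 :: nat}" by auto
  then have V: "verts G = {g 0, g 1, g 2, g 3}" using g by (simp add: bij_betw_def)
  show ?thesis
  proof (rule that[OF _ V])
    show "distinct [g 0, g 1, g 2, g 3]" using fg[of 0] fg[of 1] fg[of 2] fg[of 3] by auto
  qed (use adj V fg in \<open>simp_all add: edges_cycle_graph_four doubleton_eq_iff\<close>)
qed

text \<open>
  The 2-fold cover with identity matchings on three edges and a transposition on the edge \<open>pq\<close> forces a
  sequence of three colour changes to end where it began, which is impossible with two colours. The
  join with \<open>K\<^sub>1\<close> is a wheel.
\<close>
lemma Z_DP_four_cycle:
  assumes G: "fin_graph G" and d: "distinct [p, q, r, s]" and V: "verts G = {p, q, r, s}"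
    and adj: "adjacent G p q" "adjacent G q r" "adjacent G r s" "adjacent G s p"
    and nadj: "\<not> adjacent G p r" "\<not> adjacent G q s"
  shows "Z_DP G = 1"
proof -
  have sym: "adjacent G u v \<longleftrightarrow> adjacent G v u" for u v by (simp add: insert_commute)
  have chi: "chromatic_number G = 2"
    unfolding chromatic_number_def
  proof (rule Least_equality)
    have "(if u \<in> {p, r} then 0 else 1 :: nat) \<noteq> (if v \<in> {p, r} then 0 else 1)" if uv: "adjacent G u v" for u v
    proof -
      have "u \<noteq> v" "u \<in> {p, q, r, s}" "v \<in> {p, q, r, s}" using edge_verts[OF G uv] V by auto
      then show ?thesis using uv nadj sym[of r p] sym[of s q] by auto
    qed
    then show "colorable G 2"
      unfolding colorable_def by (intro exI[of _ "\<lambda>u. if u \<in> {p, r} then 0 else 1"]) auto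
    fix k assume "colorable G k"
    then obtain c where c: "c ` verts G \<subseteq> {..<k}" "c p \<noteq> c q" using adj(1) unfolding colorable_def by blast
    then have "c p < k" "c q < k" using V by auto
    then show "2 \<le> k" using c(2) by linarith
  qed
  have ne: "verts G \<noteq> {}" using V by simp
  show ?thesis
    unfolding Z_DP_eq_Least[OF G ne] chi
  proof (rule Least_equality)
    let ?J = "join G (complete_graph 1)"
    show "DP_fold_colorable ?J (2 + 1)"
    proof (rule DP_fold_colorableI)
      show "fin_graph ?J" by (intro fin_graph_join G fin_graph_complete_graph)
      fix L :: "'a + nat \<Rightarrow> nat set" and E
      have VJ: "verts ?J = {Inr 0, Inl p, Inl q, Inl r, Inl s}"
        unfolding verts_join verts_complete_graph V by auto
      assume cov: "cover_on (adjacent ?J) (verts ?J) L E" and card: "\<And>v. v \<in> verts ?J \<Longrightarrow> card (L v) = 2 + 1"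
      show "\<exists>h. transversal (verts ?J) L E h"
        unfolding VJ
      proof (rule transversal_wheel[of "adjacent ?J"])
        show "cover_on (adjacent ?J) {Inr 0, Inl p, Inl q, Inl r, Inl s} L E" using cov VJ by simp
        show "distinct [Inr 0, Inl p, Inl q, Inl r, Inl s]" using d by auto
        show "3 \<le> card (L v)" if "v \<in> {Inr 0, Inl p, Inl q, Inl r, Inl s}" for v using card[of v] that VJ by simp
      qed (use nadj sym[of r p] sym[of s q] in \<open>simp_all add: adjacent_join\<close>)
    qed
    fix t assume DP: "DP_fold_colorable (join G (complete_graph t)) (2 + t)"
    show "1 \<le> t"
    proof (rule ccontr)
      assume "\<not> 1 \<le> t"
      then have "t = 0" by simp
      with DP have DP0: "DP_fold_colorable (join G (complete_graph 0)) 2" by simp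
      let ?J = "join G (complete_graph 0)"
      \<comment> \<open>The bounds \<open>i < 2\<close> and \<open>j < 2\<close> make the twist a matching.\<close>
      let ?R = "\<lambda>x y i j. if {x, y} = {Inl p, Inl q} then i < 2 \<and> j < 2 \<and> i \<noteq> j else i = (j :: nat)"
      have fJ: "fin_graph ?J" by (intro fin_graph_join G fin_graph_complete_graph)
      obtain c where c: "c ` verts ?J \<subseteq> {..<2}" "\<And>x y. adjacent ?J x y \<Longrightarrow> \<not> ?R x y (c x) (c y)"
      proof -
        have "?R y x j i" if "?R x y i j" for x y i j
          using that by (auto simp: insert_commute[of x] split: if_splits)
        moreover have "j = j'" if "?R x y i j" "?R x y i j'" for x y i j j'
          using that by (auto split: if_splits)
        ultimately have "\<exists>c. c ` verts ?J \<subseteq> {..<2} \<and> (\<forall>x y. adjacent ?J x y \<longrightarrow> \<not> ?R x y (c x) (c y))"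
          by (rule ex_coloring_of_DP_fold_colorable[OF fJ DP0])
        then show ?thesis using that by blast
      qed
      have lt: "c (Inl p) < 2" "c (Inl q) < 2" "c (Inl r) < 2" "c (Inl s) < 2"
        using c(1) unfolding verts_join V by auto
      have "c (Inl q) \<noteq> c (Inl r)" "c (Inl r) \<noteq> c (Inl s)" "c (Inl s) \<noteq> c (Inl p)"
        using c(2)[of "Inl q" "Inl r"] c(2)[of "Inl r" "Inl s"] c(2)[of "Inl s" "Inl p"] adj d
        by (auto simp: adjacent_join doubleton_eq_iff)
      moreover have "c (Inl p) = c (Inl q)"
        using c(2)[of "Inl p" "Inl q"] adj lt by (auto simp: adjacent_join)
      ultimately show False using lt by linarith
    qed
  qed
qed

text \<open>
  By the pigeonhole principle, two vertices of \<open>W\<close> have the same colour.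
\<close>
lemma ex_non_adjacent_of_colorable:
  assumes "colorable G k" "W \<subseteq> verts G" "k < card W"
  shows "\<exists>u\<in>W. \<exists>v\<in>W. u \<noteq> v \<and> \<not> adjacent G u v"
proof -
  obtain c where c: "c ` verts G \<subseteq> {..<k}" "\<And>u v. adjacent G u v \<Longrightarrow> c u \<noteq> c v"
    using assms(1) unfolding colorable_def by blast
  have "card (c ` W) \<le> card {..<k}" using c(1) assms(2) by (intro card_mono) auto
  then have "\<not> inj_on c W" using assms(3) card_image by fastforce
  then show ?thesis using c(2) unfolding inj_on_def by blast
qed

text \<open>
  In the case \<open>n = k + 2\<close> the set \<open>V - {p}\<close> still has more vertices than there are colours, which provides
  the non-adjacent pairs that \<open>transversal_or_four_cycle\<close> asks for.
\<close>
lemma Z_DP_eq_zero: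
  assumes G: "fin_graph G" "verts G \<noteq> {}"
    and small: "\<not> (2 \<le> chromatic_number G \<and> chromatic_number G + 3 \<le> card (verts G))"
    and not_cycle: "\<not> graph_iso G (cycle_graph 4)"
  shows "Z_DP G = 0"
proof -
  let ?k = "chromatic_number G" and ?V = "verts G"
  note col = colorable_chromatic_number[OF G(1)]
  have "DP_fold_colorable (join G (complete_graph 0)) ?k"
  proof (rule DP_fold_colorable_join_null[OF G(1)])
    fix L :: "'a \<Rightarrow> nat set" and E
    assume cov: "cover_on (adjacent G) ?V L E" and card: "\<And>v. v \<in> ?V \<Longrightarrow> card (L v) = ?k"
    note c = cover_onD[OF cov]
    have k: "1 \<le> ?k" using chromatic_number_pos[OF G(2) col] by simp
    consider "?k = 1" | "card ?V \<le> ?k" | "card ?V = ?k + 1" | "card ?V = ?k + 2" using small k by linarith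
    then show "\<exists>h. transversal ?V L E h"
    proof cases
      case 1
      obtain f where f: "f ` ?V \<subseteq> {..<1 :: nat}" "\<And>u v. adjacent G u v \<Longrightarrow> f u \<noteq> f v"
        using col 1 unfolding colorable_def by auto
      have nadj: "\<not> adjacent G u v" if "u \<in> ?V" "v \<in> ?V" for u v
      proof -
        have "f u < 1" "f v < 1" using f(1) that by blast+
        then show ?thesis using f(2)[of u v] by auto
      qed
      have "\<exists>x. x \<in> L v" if "v \<in> ?V" for v using card[OF that] k by (metis card.empty ex_in_conv not_one_le_zero)
      then obtain h where "\<And>v. v \<in> ?V \<Longrightarrow> h v \<in> L v" by metis
      then show ?thesis using c(5) nadj unfolding transversal_def by metis
    next
      case 2
      then show ?thesis using transversal_greedy[OF cov] card by simp
    next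
      case 3
      then obtain u v where "u \<in> ?V" "v \<in> ?V" "u \<noteq> v" "\<not> adjacent G u v"
        using ex_non_adjacent_of_colorable[OF col order_refl] by auto
      then show ?thesis using transversal_of_non_adjacent_pair[OF cov, of v u] card 3 by simp
    next
      case 4
      have "\<exists>q\<in>?V - {p}. \<exists>r\<in>?V - {p}. q \<noteq> r \<and> \<not> adjacent G q r" if "p \<in> ?V" for p
        using ex_non_adjacent_of_colorable[OF col, of "?V - {p}"] that 4 by simp
      then have "(\<exists>h. transversal ?V L E h) \<or> (\<exists>p q r s. distinct [p, q, r, s] \<and> ?V = {p, q, r, s} \<and>
          adjacent G p q \<and> adjacent G q r \<and> adjacent G r s \<and> adjacent G s p \<and> \<not> adjacent G p r \<and> \<not> adjacent G q s)"
        by (intro transversal_or_four_cycle[OF cov symp_adjacent]) (use card 4 G(2) in auto)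
      then show ?thesis using not_cycle graph_iso_four_cycleI[OF _ _ G(1)] by metis
    qed
  qed
  then show ?thesis unfolding Z_DP_eq_Least[OF G] by (simp add: Least_eq_0)
qed

theorem theorem9:
  fixes G :: "'a ugraph" and n m k :: nat
  assumes "fin_graph G" and "verts G \<noteq> {}"
    and "n = card (verts G)" and "m = card (edges G)" and "k = chromatic_number G"
  shows "(2 \<le> k \<and> k + 3 \<le> n \<longrightarrow>
            int (Z_DP G) \<le> \<lceil>4 * (real k + 1) * real m / (2 * real k + 1)\<rceil>) \<and>
         (graph_iso G (cycle_graph 4) \<longrightarrow> Z_DP G = 1) \<and>
         (\<not> (2 \<le> k \<and> k + 3 \<le> n) \<and> \<not> graph_iso G (cycle_graph 4) \<longrightarrow> Z_DP G = 0)"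
proof (intro conjI impI)
  have "real (Z_DP G) \<le> 2 * real m" using Z_DP_le[OF assms(1,2)] assms(4) by (simp flip: of_nat_mult)
  also have "\<dots> \<le> 4 * (real k + 1) * real m / (2 * real k + 1)"
    by (simp add: field_simps)
  finally show "int (Z_DP G) \<le> \<lceil>4 * (real k + 1) * real m / (2 * real k + 1)\<rceil>"
    by (simp add: le_ceiling_iff)
next
  assume "graph_iso G (cycle_graph 4)"
  then show "Z_DP G = 1" by (rule four_cycle_of_graph_iso) (rule Z_DP_four_cycle[OF assms(1)])
next
  assume "\<not> (2 \<le> k \<and> k + 3 \<le> n) \<and> \<not> graph_iso G (cycle_graph 4)"
  then show "Z_DP G = 0" using Z_DP_eq_zero[OF assms(1,2)] assms(3,5) by blast
qed

end
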